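(* Let $(G,S)$ be the Cayley graph of a group of polynomial growth with homogeneous dimension $N\ge3$. For $r,s>1$ and $0<\alpha<N$ with $\frac1r+\frac1s+\frac{N-\alpha}{N}=2$, there is a constant $C_{r,s,\alpha}$ (depending on $r,s,\alpha$ and $(G,S)$) such that the discrete Hardy--Littlewood--Sobolev inequality $$\sum_{x,y\in G,\ x\ne y}R_\alpha(x,y)f(x)g(y)\le C_{r,s,\alpha}\lVert f\rVert_{\ell^r}\lVert g\rVert_{\ell^s},\qquad\forall f\in\ell^r(G),\ g\in\ell^s(G),$$ holds. An equivalent form is the following: for $0<\alpha<N$, $1<r<\frac N\alpha$ and $t=\frac{Nr}{N-\alpha r}$, there is a constant $C_{r,\alpha}$ such that $$\lVert R_\alpha\ast f\rVert_{\ell^t}\le C_{r,\alpha}\lVert f\rVert_{\ell^r},\qquad\forall f\in\ell^r(G).$$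
   Context: $G$ is a group with a finite symmetric generating set $S=S^{-1}$. The Cayley graph $(G,S)$ has vertex set $G$, and $x\sim y$ iff $x=ys$ for some $s\in S$. $d^S$ is the word (graph) metric, $e$ is the unit element, and $\beta_S(n)=\#\{x\in G: d^S(e,x)\le n\}$. $G$ has polynomial growth with homogeneous dimension $N\in\mathbb N$ if there are constants $C_1,C_2>0$ with $C_1n^N\le\beta_S(n)\le C_2n^N$ for all $n\ge1$. For $u:G\to\mathbb R$, $\Delta u(x)=\sum_{y\sim x}(u(y)-u(x))$. Let $k_t(x,y)$ be the heat kernel of $\Delta$, i.e. the kernel of the semigroup $e^{t\Delta}$. The Green's function of the fractional Laplacian $(-\Delta)^{\alpha/2}$ is $$R_\alpha(x,y)=\frac1{\Gamma(\alpha/2)}\int_0^\infty k_t(x,y)\,t^{-1+\alpha/2}\,dt,\qquad x,y\in G,$$ and $(R_\alpha\ast f)(x)=\sum_{y\in G}R_\alpha(x,y)f(y)$. *)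

theory Defs
  imports "HOL-Analysis.Analysis" "HOL-Algebra.Generated_Groups"
begin

definition symmetric_generating_set :: "('a, 'b) monoid_scheme \<Rightarrow> 'a set \<Rightarrow> bool" where
  "symmetric_generating_set G S \<longleftrightarrow>
     finite S \<and> S \<subseteq> carrier G \<and> (\<lambda>s. inv\<^bsub>G\<^esub> s) ` S = S \<and> generate G S = carrier G"

definition cayley_adj :: "('a, 'b) monoid_scheme \<Rightarrow> 'a set \<Rightarrow> ('a \<times> 'a) set" where
  "cayley_adj G S = {(x, y). x \<in> carrier G \<and> y \<in> carrier G \<and> (\<exists>s\<in>S. x = y \<otimes>\<^bsub>G\<^esub> s)}"

text \<open>Least length of a path. The Cayley graph of a generating set is connected,
  so the minimum is over a nonempty set for all pairs of group elements.\<close>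
definition cayley_dist :: "('a, 'b) monoid_scheme \<Rightarrow> 'a set \<Rightarrow> 'a \<Rightarrow> 'a \<Rightarrow> nat" where
  "cayley_dist G S x y = (LEAST n. (x, y) \<in> cayley_adj G S ^^ n)"

definition growth :: "('a, 'b) monoid_scheme \<Rightarrow> 'a set \<Rightarrow> nat \<Rightarrow> nat" where
  "growth G S n = card {x \<in> carrier G. cayley_dist G S \<one>\<^bsub>G\<^esub> x \<le> n}"

definition polynomial_growth :: "('a, 'b) monoid_scheme \<Rightarrow> 'a set \<Rightarrow> nat \<Rightarrow> bool" where
  "polynomial_growth G S N \<longleftrightarrow>
     (\<exists>C1 C2 :: real. C1 > 0 \<and> C2 > 0 \<and>
        (\<forall>n::nat. n \<ge> 1 \<longrightarrow> C1 * real n ^ N \<le> real (growth G S n) \<and>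
                              real (growth G S n) \<le> C2 * real n ^ N))"

definition laplacian :: "('a, 'b) monoid_scheme \<Rightarrow> 'a set \<Rightarrow> ('a \<Rightarrow> real) \<Rightarrow> 'a \<Rightarrow> real" where
  "laplacian G S u x = (\<Sum>y | (y, x) \<in> cayley_adj G S. u y - u x)"

text \<open>The Laplacian is a bounded operator because the vertex degrees are at most \<open>card S\<close>,
  so the semigroup it generates is given by the exponential series. The series converges for
  every bounded \<open>u\<close>, see \<open>summable_heat_semigroup\<close> below.\<close>
definition heat_semigroup ::
    "('a, 'b) monoid_scheme \<Rightarrow> 'a set \<Rightarrow> real \<Rightarrow> ('a \<Rightarrow> real) \<Rightarrow> 'a \<Rightarrow> real" where
  "heat_semigroup G S t u x = (\<Sum>n. t ^ n / fact n * (laplacian G S ^^ n) u x)"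

text \<open>The kernel with respect to the counting measure, obtained by applying the semigroup to
  the unit mass at \<open>y\<close>.\<close>
definition heat_kernel ::
    "('a, 'b) monoid_scheme \<Rightarrow> 'a set \<Rightarrow> real \<Rightarrow> 'a \<Rightarrow> 'a \<Rightarrow> real" where
  "heat_kernel G S t x y = heat_semigroup G S t (indicator {y}) x"

definition green :: "('a, 'b) monoid_scheme \<Rightarrow> 'a set \<Rightarrow> real \<Rightarrow> 'a \<Rightarrow> 'a \<Rightarrow> real" where
  "green G S \<alpha> x y =
     1 / Gamma (\<alpha> / 2) * (LBINT t:{0<..}. heat_kernel G S t x y * t powr (-1 + \<alpha> / 2))"

definition green_conv ::
    "('a, 'b) monoid_scheme \<Rightarrow> 'a set \<Rightarrow> real \<Rightarrow> ('a \<Rightarrow> real) \<Rightarrow> 'a \<Rightarrow> real" where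
  "green_conv G S \<alpha> f x = (\<Sum>\<^sub>\<infinity>y\<in>carrier G. green G S \<alpha> x y * f y)"

definition lp_space :: "'a set \<Rightarrow> real \<Rightarrow> ('a \<Rightarrow> real) set" where
  "lp_space A p = {f. (\<lambda>x. \<bar>f x\<bar> powr p) summable_on A}"

definition lp_norm :: "'a set \<Rightarrow> real \<Rightarrow> ('a \<Rightarrow> real) \<Rightarrow> real" where
  "lp_norm A p f = (\<Sum>\<^sub>\<infinity>x\<in>A. \<bar>f x\<bar> powr p) powr (1 / p)"

lemma summable_heat_semigroup:
  assumes "group G" "symmetric_generating_set G S" and u: "\<And>x. \<bar>u x\<bar> \<le> B"
  shows "summable (\<lambda>n. t ^ n / fact n * (laplacian G S ^^ n) u x)"
proof -
  interpret group G by fact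
  have S: "finite S" "S \<subseteq> carrier G"
    using assms(2) by (auto simp: symmetric_generating_set_def)
  define D where "D = real (card S)"
  have nb: "real (card {y. (y, x) \<in> cayley_adj G S}) \<le> D" for x
  proof -
    have "{y. (y, x) \<in> cayley_adj G S} \<subseteq> (\<lambda>s. x \<otimes>\<^bsub>G\<^esub> s) ` S"
      by (auto simp: cayley_adj_def)
    then show ?thesis
      unfolding D_def using S by (meson of_nat_le_iff surj_card_le)
  qed
  have B: "B \<ge> 0" using u[of x] by linarith
  have bound: "\<bar>(laplacian G S ^^ n) u x\<bar> \<le> (2 * D) ^ n * B" for n x
  proof (induction n arbitrary: x)
    case 0
    then show ?case using u by simp
  next
    case (Suc n)
    let ?v = "(laplacian G S ^^ n) u" and ?M = "(2 * D) ^ n * B"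
    have "\<bar>laplacian G S ?v x\<bar> \<le> (\<Sum>y | (y, x) \<in> cayley_adj G S. \<bar>?v y - ?v x\<bar>)"
      unfolding laplacian_def by (rule sum_abs)
    also have "\<dots> \<le> (\<Sum>y | (y, x) \<in> cayley_adj G S. 2 * ?M)"
    proof (rule sum_mono)
      fix y
      show "\<bar>?v y - ?v x\<bar> \<le> 2 * ?M"
        using Suc.IH[of y] Suc.IH[of x] by linarith
    qed
    also have "\<dots> = real (card {y. (y, x) \<in> cayley_adj G S}) * (2 * ?M)"
      by simp
    also have "\<dots> \<le> D * (2 * ?M)"
      using B by (intro mult_right_mono nb) (auto simp: D_def)
    finally show ?case by (simp add: mult_ac)
  qed
  show ?thesis
  proof (rule summable_comparison_test')
    show "summable (\<lambda>n. B * (inverse (fact n) * (\<bar>t\<bar> * (2 * D)) ^ n))"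
      by (intro summable_mult summable_exp)
    fix n :: nat
    have "norm (t ^ n / fact n * (laplacian G S ^^ n) u x)
        \<le> \<bar>t\<bar> ^ n / fact n * ((2 * D) ^ n * B)"
      using bound[of n x] by (simp add: abs_mult power_abs mult_left_mono divide_right_mono)
    then show "norm (t ^ n / fact n * (laplacian G S ^^ n) u x)
        \<le> B * (inverse (fact n) * (\<bar>t\<bar> * (2 * D)) ^ n)"
      by (simp add: field_simps power_mult_distrib)
  qed
qed

end

theory Submission
  imports Defs
begin

text \<open>
  Write \<open>P f x\<close> for the average of \<open>f (x s)\<close> over \<open>s \<in> S\<close> and \<open>D = card S\<close>. Since \<open>\<Delta> = D (P - 1)\<close>, the heat
  kernel is a Poisson mixture of the kernels of the powers of \<open>P\<close>, and integrating in time turns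
  \<open>R\<^sub>\<alpha>\<close> into \<open>D powr -\<beta>\<close> times \<open>\<Sum>n. c n * P^n\<close> with \<open>\<beta> = \<alpha> / 2\<close> and \<open>c n = pochhammer \<beta> n / fact n\<close>,
  which is of order \<open>n powr (\<beta> - 1)\<close>. So everything takes place in discrete time.

  If \<open>w\<close> is a product of \<open>2 n\<close> generators, then \<open>f\<close> and its translate by \<open>w\<close> differ in squared \<open>\<ell>\<^sup>2\<close> norm
  by at most \<open>2 n\<^sup>2 D\<^sup>2 (\<parallel>f\<parallel>\<^sup>2 - \<parallel>P f\<parallel>\<^sup>2)\<close>. Averaging over \<open>w\<close> yields a Nash inequality that involves only the
  lower volume bound, and iterating it gives the decay \<open>n powr -(N / 2)\<close> of the kernel of \<open>P^n\<close>.
  Using words of even length avoids any difficulty with bipartite Cayley graphs.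

  For \<open>\<parallel>f\<parallel>\<^sub>r \<le> 1\<close> and \<open>\<gamma> = N / (2 r)\<close>, cut the sum over \<open>n\<close> at \<open>T\<close> and \<open>f\<close> at height \<open>h = T powr -\<gamma>\<close>: both errors
  are bounded pointwise by a multiple of \<open>T powr (\<beta> - \<gamma>)\<close>, and the remaining part, the first \<open>T\<close> terms
  applied to \<open>f\<close> restricted to \<open>{f > h}\<close>, is controlled in \<open>\<ell>\<^sup>1\<close>. Summing over \<open>T = 2^j\<close>, as in the
  Marcinkiewicz interpolation theorem, gives the \<open>\<ell>\<^sup>r\<close>-\<open>\<ell>\<^sup>t\<close> bound, and duality gives the bilinear form.
\<close>

section \<open>Real sequences, sums and integrals\<close>

text \<open>Mean value theorem: the difference is \<open>a * z powr (a - 1)\<close> with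
  \<open>n < z < n + 1 \<le> 2 * n\<close>, and the minimum covers both monotonicities of
  \<open>z powr (a - 1)\<close>. Power sums are thereby compared with telescoping sums.\<close>

lemma powr_diff_ge:
  fixes a :: real
  assumes "n \<ge> 1"
  shows "\<bar>a\<bar> * min 1 (2 powr (a - 1)) * real n powr (a - 1) \<le> \<bar>real (Suc n) powr a - real n powr a\<bar>"
proof -
  have "\<exists>z>real n. z < real (Suc n) \<and> real (Suc n) powr a - real n powr a =
      (real (Suc n) - real n) * (a * z powr (a - 1))"
    using assms by (intro MVT2) (auto intro!: derivative_eq_intros)
  then obtain z where z: "z > real n" "z < real n + 1"
    and eq: "real (Suc n) powr a - real n powr a = a * z powr (a - 1)"
    by (auto simp: algebra_simps)
  have "min 1 (2 powr (a - 1)) * real n powr (a - 1) \<le> z powr (a - 1)"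
  proof (cases "a \<ge> 1")
    case True
    have "min 1 (2 powr (a - 1)) * real n powr (a - 1) \<le> 1 * real n powr (a - 1)"
      by (intro mult_right_mono) auto
    also have "\<dots> \<le> z powr (a - 1)"
      using z True by (simp add: powr_mono2)
    finally show ?thesis .
  next
    case False
    have "min 1 (2 powr (a - 1)) * real n powr (a - 1) \<le> 2 powr (a - 1) * real n powr (a - 1)"
      by (intro mult_right_mono) auto
    also have "\<dots> = (2 * real n) powr (a - 1)"
      by (simp add: powr_mult)
    also have "\<dots> \<le> z powr (a - 1)"
      using z False assms by (intro powr_mono2') auto
    finally show ?thesis .
  qed
  then have "\<bar>a\<bar> * (min 1 (2 powr (a - 1)) * real n powr (a - 1)) \<le> \<bar>a\<bar> * z powr (a - 1)"
    by (rule mult_left_mono) simp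
  then show ?thesis
    unfolding eq by (simp add: abs_mult mult_ac)
qed

text \<open>Each summand is at most a multiple of
  \<open>n powr -\<delta> - (n + 1) powr -\<delta>\<close>, and these differences telescope to their
  first term. The constant does not depend on the starting point \<open>m\<close>.\<close>

lemma powr_tail_bound:
  fixes \<delta> :: real
  assumes "\<delta> > 0"
  obtains C where "C \<ge> 0"
    "\<And>m. m \<ge> 1 \<Longrightarrow> summable (\<lambda>n. real (n + m) powr (- 1 - \<delta>))"
    "\<And>m. m \<ge> 1 \<Longrightarrow> (\<Sum>n. real (n + m) powr (- 1 - \<delta>)) \<le> C * real m powr (- \<delta>)"
proof -
  define c where "c = \<delta> * min 1 (2 powr (- \<delta> - 1))"
  have c: "c > 0" using assms by (simp add: c_def)
  have le: "real n powr (- 1 - \<delta>) \<le> inverse c * (real n powr - \<delta> - real (Suc n) powr - \<delta>)"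
    if "n \<ge> 1" for n
  proof -
    have "real (Suc n) powr - \<delta> \<le> real n powr - \<delta>"
      using that assms by (intro powr_mono2') auto
    then have "c * real n powr (- \<delta> - 1) \<le> real n powr - \<delta> - real (Suc n) powr - \<delta>"
      using powr_diff_ge[OF that, of "-\<delta>"] assms by (simp add: c_def)
    also have "- \<delta> - 1 = - 1 - \<delta>" by simp
    finally show ?thesis using c by (simp add: field_simps)
  qed
  have sums: "(\<lambda>n. inverse c * (real (n + m) powr - \<delta> - real (Suc (n + m)) powr - \<delta>)) sums
      (inverse c * real m powr - \<delta>)" for m
  proof -
    have "(\<lambda>n. real (n + m) powr - \<delta>) \<longlonglongrightarrow> 0"
      by (rule LIMSEQ_ignore_initial_segment)
        (use assms in \<open>auto intro!: tendsto_neg_powr filterlim_real_sequentially\<close>)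
    from telescope_sums'[OF this] show ?thesis
      by (intro sums_mult) simp
  qed
  show ?thesis
  proof (rule that[of "inverse c"])
    show "inverse c \<ge> 0" using c by simp
    fix m :: nat assume m: "m \<ge> 1"
    show s: "summable (\<lambda>n. real (n + m) powr (- 1 - \<delta>))"
    proof (rule summable_comparison_test'[OF sums_summable[OF sums[of m]], of 0])
      fix n :: nat
      show "norm (real (n + m) powr (- 1 - \<delta>)) \<le>
          inverse c * (real (n + m) powr - \<delta> - real (Suc (n + m)) powr - \<delta>)"
        using le[of "n + m"] m by simp
    qed
    have "(\<Sum>n. real (n + m) powr (- 1 - \<delta>)) \<le>
        (\<Sum>n. inverse c * (real (n + m) powr - \<delta> - real (Suc (n + m)) powr - \<delta>))"
      by (intro suminf_le s sums_summable[OF sums[of m]] le) (use m in auto)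
    also have "\<dots> = inverse c * real m powr - \<delta>"
      using sums by (rule sums_unique[symmetric])
    finally show "(\<Sum>n. real (n + m) powr (- 1 - \<delta>)) \<le> inverse c * real m powr - \<delta>" .
  qed
qed

text \<open>Telescoping again, now with the differences of \<open>n powr \<beta>\<close>.\<close>

lemma powr_partial_sum_bound:
  fixes \<beta> :: real
  assumes "\<beta> > 0"
  obtains C where "C \<ge> 0"
    "\<And>m. (\<Sum>n=1..<m. real n powr (\<beta> - 1)) \<le> C * real m powr \<beta>"
proof -
  define c where "c = \<beta> * min 1 (2 powr (\<beta> - 1))"
  have c: "c > 0" using assms by (simp add: c_def)
  have le: "real n powr (\<beta> - 1) \<le> inverse c * (real (Suc n) powr \<beta> - real n powr \<beta>)"
    if "n \<ge> 1" for n
  proof -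
    have "real n powr \<beta> \<le> real (Suc n) powr \<beta>"
      using that assms by (intro powr_mono2) auto
    then have "c * real n powr (\<beta> - 1) \<le> real (Suc n) powr \<beta> - real n powr \<beta>"
      using powr_diff_ge[OF that, of \<beta>] assms by (simp add: c_def)
    then show ?thesis using c by (simp add: field_simps)
  qed
  have "(\<Sum>n=1..<m. real n powr (\<beta> - 1)) \<le> inverse c * real m powr \<beta>" for m
  proof (cases "m \<ge> 1")
    case True
    have "(\<Sum>n=1..<m. real n powr (\<beta> - 1)) \<le>
        (\<Sum>n=1..<m. inverse c * (real (Suc n) powr \<beta> - real n powr \<beta>))"
      by (intro sum_mono le) auto
    also have "\<dots> = inverse c * (real m powr \<beta> - 1)"
      using True sum_Suc_diff'[of 1 m "\<lambda>n. real n powr \<beta>"]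
      by (simp flip: sum_distrib_left)
    also have "\<dots> \<le> inverse c * real m powr \<beta>"
      using c by (intro mult_left_mono) auto
    finally show ?thesis .
  qed (use c in auto)
  then show ?thesis using c by (intro that[of "inverse c"]) auto
qed

text \<open>The sequence \<open>rGamma_series \<beta>\<close> converges, hence is bounded. Its last
  factor \<open>\<beta> + n\<close> is at least \<open>n\<close>, which lowers the exponent by
  one.\<close>

lemma pochhammer_fact_bound:
  fixes \<beta> :: real
  assumes "\<beta> > 0"
  obtains M where "M \<ge> 0"
    "\<And>n. n \<ge> 1 \<Longrightarrow> pochhammer \<beta> n / fact n \<le> M * real n powr (\<beta> - 1)"
proof -
  have "Bseq (rGamma_series \<beta>)"
    by (intro convergent_imp_Bseq convergentI[OF rGamma_series_LIMSEQ])
  then obtain M where M: "M > 0" "\<And>n. \<bar>rGamma_series \<beta> n\<bar> \<le> M"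
    by (auto simp: Bseq_def)
  have "pochhammer \<beta> n / fact n \<le> M * real n powr (\<beta> - 1)" if n: "n \<ge> 1" for n
  proof -
    have e: "exp (\<beta> * ln (real n)) = real n powr \<beta>"
      using n by (simp add: powr_def)
    have "rGamma_series \<beta> n = pochhammer \<beta> n * (\<beta> + n) / (fact n * real n powr \<beta>)"
      using e by (simp add: rGamma_series_def pochhammer_Suc)
    with abs_le_D1[OF M(2)[of n]]
    have "pochhammer \<beta> n * (\<beta> + n) / (fact n * real n powr \<beta>) \<le> M" by simp
    then have "pochhammer \<beta> n * (\<beta> + n) / fact n \<le> M * real n powr \<beta>"
      using n by (simp add: field_simps)
    moreover have "pochhammer \<beta> n * n \<le> pochhammer \<beta> n * (\<beta> + n)"
      using assms by (intro mult_left_mono pochhammer_nonneg) auto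
    ultimately have "pochhammer \<beta> n * n / fact n \<le> M * real n powr \<beta>"
      by (smt (verit) divide_right_mono fact_ge_zero)
    then show ?thesis using n by (simp add: powr_diff field_simps)
  qed
  then show ?thesis using M(1) by (intro that[of M]) auto
qed

text \<open>A Bernoulli inequality for negative exponents, from \<open>exp x \<ge> 1 + x\<close> and
  \<open>ln (1 + y) \<le> y\<close>.\<close>

lemma one_plus_inverse_powr_ge:
  fixes b m :: real
  assumes "b \<ge> 0" "m > 0"
  shows "m powr - b * (1 - b / m) \<le> (m + 1) powr - b"
proof -
  have "1 - b / m \<le> 1 - b * ln (1 + 1 / m)"
    using mult_left_mono[OF ln_add_one_self_le_self[of "1 / m"], of b] assms by simp
  also have "\<dots> \<le> exp (- (b * ln (1 + 1 / m)))"
    using exp_ge_add_one_self[of "- (b * ln (1 + 1 / m))"] by simp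
  also have "\<dots> = (1 + 1 / m) powr - b"
    using assms add_pos_pos[of 1 "1 / m"] by (auto simp: powr_def)
  finally have "m powr - b * (1 - b / m) \<le> m powr - b * (1 + 1 / m) powr - b"
    by (intro mult_left_mono) auto
  also have "\<dots> = (m + 1) powr - b"
  proof -
    have "m * (1 + 1 / m) = m + 1" using assms by (simp add: field_simps)
    then show ?thesis using assms by (simp flip: powr_mult)
  qed
  finally show ?thesis .
qed

text \<open>A discrete counterpart of integrating a differential inequality. At time
  \<open>m = k + 1\<close> the free parameter \<open>n\<close> is taken near
  \<open>sqrt (m / (N * A))\<close>, which balances the gain from the drop
  \<open>u k - u (Suc k)\<close> against the error \<open>K / n ^ N\<close>.\<close>

lemma nash_recursion_decay:
  fixes u :: "nat \<Rightarrow> real" and A K :: real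
  assumes u: "\<And>k. u k \<le> 1" and A: "A \<ge> 1" and K: "K \<ge> 0" and N: "N \<ge> 1"
    and rec: "\<And>k n. n \<ge> 1 \<Longrightarrow> u k \<le> A * real n ^ 2 * (u k - u (Suc k)) + K / real n ^ N"
  obtains C where "C \<ge> 0" "\<And>k. u k \<le> C * real (Suc k) powr - (real N / 2)"
proof -
  \<comment> \<open>Chosen so that the error term becomes
    \<open>K / n ^ N \<le> K' * m powr -(N / 2)\<close> once \<open>n\<close> is at least
    \<open>q / 2\<close>.\<close>
  define K' where "K' = K * 2 ^ N * (real N * A) powr (real N / 2)"
  \<comment> \<open>The first entry leaves \<open>C - K' \<ge> C / 2\<close> in the inductive step;
    the second lets the claim follow from \<open>u \<le> 1\<close> as long as
    \<open>m < N * A\<close>.\<close>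
  define C where "C = max (2 * K') ((real N * A + 1) powr (real N / 2))"
  have NA: "real N * A \<ge> 1" using N A mult_mono[of 1 "real N" 1 A] by simp
  have K': "K' \<ge> 0" using K by (simp add: K'_def)
  have C2: "(real N * A + 1) powr (real N / 2) \<le> C" "2 * K' \<le> C" by (auto simp: C_def)
  have C1: "1 \<le> C"
    using C2(1) ge_one_powr_ge_zero[of "real N * A + 1" "real N / 2"] NA by simp
  have "u k \<le> C * real (Suc k) powr - (real N / 2)" for k
  proof (induction k)
    case 0
    then show ?case using u[of 0] C1 by simp
  next
    case (Suc k)
    define m where "m = real (Suc k)"
    have m: "m \<ge> 1" by (simp add: m_def)
    show ?case
    proof (cases "m < real N * A")
      case True
      have "u (Suc k) \<le> (m + 1) powr (real N / 2) * (m + 1) powr - (real N / 2)"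
        using u[of "Suc k"] m by (simp add: powr_add[symmetric])
      also have "\<dots> \<le> C * (m + 1) powr - (real N / 2)"
      proof (intro mult_right_mono)
        have "(m + 1) powr (real N / 2) \<le> (real N * A + 1) powr (real N / 2)"
          using True m by (intro powr_mono2) auto
        then show "(m + 1) powr (real N / 2) \<le> C" using C2 by simp
      qed simp
      finally show ?thesis by (simp add: m_def add.commute)
    next
      case False
      define q where "q = sqrt (m / (real N * A))"
      have q: "q \<ge> 1" "q ^ 2 = m / (real N * A)" using False NA m by (auto simp: q_def)
      define n where "n = nat \<lfloor>q\<rfloor>"
      have n: "n \<ge> 1" using q by (simp add: n_def le_nat_floor)
      have nq: "real n \<le> q" using q by (simp add: n_def)
      have qn: "q \<le> 2 * real n" using n q unfolding n_def by linarith
      \<comment> \<open>Solved for \<open>u (Suc k)\<close>, the recursion contracts by the factor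
        \<open>1 - a\<close>. Since \<open>n \<le> q\<close>, \<open>a\<close> is at least
        \<open>N / m\<close>.\<close>
      define a where "a = 1 / (A * real n ^ 2)"
      have An: "A * real n ^ 2 \<ge> 1"
        using A n mult_mono[of 1 A 1 "real n ^ 2"] by (simp add: one_le_power)
      have a: "0 \<le> a" "a \<le> 1" using An by (auto simp: a_def)
      have "A * real n ^ 2 \<le> A * q ^ 2"
        using nq A by (intro mult_left_mono power_mono) auto
      also have "\<dots> = m / real N" using q A by simp
      finally have aN: "real N / m \<le> a"
        using An N m unfolding a_def by (simp add: field_simps)
      have "K / real n ^ N \<le> K * 2 ^ N / q ^ N"
      proof -
        have "q ^ N \<le> 2 ^ N * real n ^ N"
          using qn q power_mono[of q "2 * real n" N] by (simp add: power_mult_distrib)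
        then have "K * q ^ N \<le> K * (2 ^ N * real n ^ N)" using K by (rule mult_left_mono)
        then show ?thesis using n q by (simp add: field_simps)
      qed
      also have "q ^ N = (m / (real N * A)) powr (real N / 2)"
        using q(1) m N A powr_realpow[of q N]
        by (simp add: q_def powr_half_sqrt[symmetric] powr_powr)
      also have "K * 2 ^ N / (m / (real N * A)) powr (real N / 2) = K' * m powr - (real N / 2)"
        using m NA by (simp add: K'_def powr_divide powr_minus field_simps)
      finally have Kn: "K / real n ^ N \<le> K' * m powr - (real N / 2)" .
      have r1: "u k * a \<le> u k - u (Suc k) + a * (K / real n ^ N)"
      proof -
        have "u k * a \<le> (A * real n ^ 2 * (u k - u (Suc k)) + K / real n ^ N) * a"
          using rec[OF n, of k] a by (intro mult_right_mono) auto
        also have "\<dots> = u k - u (Suc k) + a * (K / real n ^ N)"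
        proof -
          have "(A * real n ^ 2) * a = 1" using A n by (simp add: a_def)
          moreover have "((A * real n ^ 2) * d + e) * a = d * ((A * real n ^ 2) * a) + a * e" for d e
            by (simp add: algebra_simps)
          ultimately show ?thesis by simp
        qed
        finally show ?thesis .
      qed
      have "u (Suc k) \<le> u k * (1 - a) + a * (K / real n ^ N)"
        using r1 by (simp add: algebra_simps)
      also have "\<dots> \<le> C * m powr - (real N / 2) * (1 - a) + a * (K' * m powr - (real N / 2))"
        using Suc.IH a Kn by (intro add_mono mult_mono mult_left_mono) (auto simp: m_def C1 order_trans[OF _ C1])
      also have "\<dots> = m powr - (real N / 2) * (C - a * (C - K'))"
        by (simp add: algebra_simps)
      \<comment> \<open>Half of the contraction survives the error term. The remaining factor
        \<open>1 - (N / 2) / m\<close> is exactly what the Bernoulli inequality admits when passing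
        from \<open>m\<close> to \<open>m + 1\<close>.\<close>
      also have "\<dots> \<le> m powr - (real N / 2) * (C - (real N / m) * (C / 2))"
      proof (intro mult_left_mono diff_left_mono)
        show "real N / m * (C / 2) \<le> a * (C - K')"
          using aN a C1 C2 by (intro mult_mono) auto
      qed auto
      also have "\<dots> = C * (m powr - (real N / 2) * (1 - (real N / 2) / m))"
        by (simp add: algebra_simps)
      also have "\<dots> \<le> C * (m + 1) powr - (real N / 2)"
        using one_plus_inverse_powr_ge[of "real N / 2" m] m C1 by (intro mult_left_mono) auto
      finally show ?thesis by (simp add: m_def add.commute)
    qed
  qed
  then show ?thesis using C1 by (intro that[of C]) auto
qed

text \<open>Adding all exponents from \<open>Min A\<close> on gives a full geometric series. Later
  \<open>A\<close> is the set of scales at which a value exceeds the truncation height, and only the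
  first of them counts.\<close>

lemma geometric_sum_Min_le:
  fixes q :: real
  assumes "0 < q" "q < 1" "finite A" "A \<noteq> {}"
  shows "(\<Sum>j\<in>A. q ^ j) \<le> q ^ Min A / (1 - q)"
proof -
  define k where "k = Min A"
  have k: "j \<ge> k" if "j \<in> A" for j using that assms by (simp add: k_def)
  have "(\<Sum>j\<in>A. q ^ j) \<le> (\<Sum>j\<in>{k..Max A}. q ^ j)"
    using assms k by (intro sum_mono2) auto
  also have "\<dots> = (\<Sum>j\<in>{0..Max A - k}. q ^ (j + k))"
    using assms k[OF Max_in[OF assms(3,4)]]
    by (intro sum.reindex_bij_witness[of _ "\<lambda>j. j + k" "\<lambda>j. j - k"]) auto
  also have "\<dots> = q ^ k * (\<Sum>j\<in>{..Max A - k}. q ^ j)"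
    by (simp add: power_add sum_distrib_left mult.commute atLeast0AtMost)
  also have "(\<Sum>j\<in>{..Max A - k}. q ^ j) \<le> (\<Sum>j. q ^ j)"
    using assms by (intro sum_le_suminf summable_geometric) auto
  also have "(\<Sum>j. q ^ j) = 1 / (1 - q)"
    using assms by (intro suminf_geometric) auto
  finally show ?thesis using assms by (simp add: k_def)
qed

section \<open>Interchange of sums and elementary inequalities\<close>

lemma has_sum_finite_sum:
  fixes f :: "'i \<Rightarrow> 'b \<Rightarrow> real"
  assumes "\<And>i. i \<in> I \<Longrightarrow> (f i has_sum a i) A"
  shows "((\<lambda>x. \<Sum>i\<in>I. f i x) has_sum (\<Sum>i\<in>I. a i)) A"
  using assms by (induction I rule: infinite_finite_induct) (auto intro: has_sum_add)

lemma infsum_finite_sum: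
  fixes f :: "'i \<Rightarrow> 'x \<Rightarrow> real"
  assumes "\<And>i. i \<in> I \<Longrightarrow> f i summable_on A"
  shows "(\<Sum>\<^sub>\<infinity>x\<in>A. \<Sum>i\<in>I. f i x) = (\<Sum>i\<in>I. \<Sum>\<^sub>\<infinity>x\<in>A. f i x)"
  using assms by (intro infsumI has_sum_finite_sum has_sum_infsum)

lemma has_sum_diff:
  fixes f g :: "'x \<Rightarrow> real"
  assumes "(f has_sum a) A" "(g has_sum b) A"
  shows "((\<lambda>x. f x - g x) has_sum (a - b)) A"
  using has_sum_add[OF assms(1) has_sum_cmult_right[OF assms(2), of "-1"]] by simp

text \<open>Up to normalization, the variance formula. It is applied to the values of a function at
  the neighbours of a point.\<close>

lemma sum_sum_diff_square:
  fixes a :: "'i \<Rightarrow> real"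
  shows "(\<Sum>s\<in>I. \<Sum>t\<in>I. (a s - a t)\<^sup>2) = 2 * real (card I) * (\<Sum>s\<in>I. (a s)\<^sup>2) - 2 * (\<Sum>s\<in>I. a s)\<^sup>2"
proof -
  have "(\<Sum>s\<in>I. \<Sum>t\<in>I. (a s - a t)\<^sup>2) =
      (\<Sum>s\<in>I. \<Sum>t\<in>I. (a s)\<^sup>2 + (a t)\<^sup>2 - 2 * (a s * a t))"
    by (simp add: power2_diff mult.assoc)
  also have "\<dots> = 2 * real (card I) * (\<Sum>s\<in>I. (a s)\<^sup>2) - 2 * (\<Sum>s\<in>I. \<Sum>t\<in>I. a s * a t)"
    by (simp add: sum.distrib sum_subtractf sum_distrib_left mult.assoc)
  also have "(\<Sum>s\<in>I. \<Sum>t\<in>I. a s * a t) = (\<Sum>s\<in>I. a s)\<^sup>2"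
    by (simp add: sum_product power2_eq_square)
  finally show ?thesis .
qed

text \<open>The weights are such that bounds \<open>n ^ 2 * K\<close> for the first square and
  \<open>K\<close> for the second add up to \<open>(n + 1) ^ 2 * K\<close>.\<close>

lemma square_add_le_weighted:
  fixes a b :: real
  assumes "n > 0"
  shows "(a + b)\<^sup>2 \<le> (1 + 1 / n) * a\<^sup>2 + (1 + n) * b\<^sup>2"
proof -
  have "0 \<le> (a / sqrt n - sqrt n * b)\<^sup>2" by simp
  also have "\<dots> = a\<^sup>2 / n + n * b\<^sup>2 - 2 * a * b"
    using assms by (simp add: power2_diff power_divide power_mult_distrib)
  finally show ?thesis by (simp add: power2_sum algebra_simps)
qed

text \<open>Above \<open>h\<close>, write \<open>v = v powr (1 - r) * v powr r\<close> and use that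
  the first factor decreases in \<open>v\<close>.\<close>

lemma le_truncation:
  fixes v h r :: real
  assumes "v \<ge> 0" "h > 0" "r \<ge> 1"
  shows "v \<le> h + h powr (1 - r) * v powr r"
    and "(if v > h then v else 0) \<le> h powr (1 - r) * v powr r"
proof -
  show le: "(if v > h then v else 0) \<le> h powr (1 - r) * v powr r"
  proof (cases "v > h")
    case True
    then have "v = v powr (1 - r) * v powr r"
      using assms by (simp flip: powr_add)
    also have "\<dots> \<le> h powr (1 - r) * v powr r"
      using True assms by (intro mult_right_mono powr_mono2') auto
    finally show ?thesis using True by simp
  qed simp
  show "v \<le> h + h powr (1 - r) * v powr r"
    using le assms by (cases "v > h") (auto intro: add_increasing2)
qed

text \<open>The Taylor coefficients of \<open>(1 - z) powr -\<beta>\<close>, so that the series of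
  powers of the averaging operator with these weights is a fractional inverse.\<close>

definition rising_binomial :: "real \<Rightarrow> nat \<Rightarrow> real" where
  "rising_binomial \<beta> n = pochhammer \<beta> n / fact n"

lemma rising_binomial_nonneg: "\<beta> > 0 \<Longrightarrow> rising_binomial \<beta> n \<ge> 0"
  by (simp add: rising_binomial_def pochhammer_nonneg)

lemma rising_binomial_partial_sum_bound:
  fixes \<beta> :: real
  assumes "\<beta> > 0"
  obtains C where "C > 0" "\<And>T. T \<ge> 1 \<Longrightarrow> (\<Sum>n<T. rising_binomial \<beta> n) \<le> C * real T powr \<beta>"
proof -
  obtain M where M: "M \<ge> 0" "\<And>n. n \<ge> 1 \<Longrightarrow> pochhammer \<beta> n / fact n \<le> M * real n powr (\<beta> - 1)"
    using pochhammer_fact_bound[OF assms] by blast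
  obtain C where C: "C \<ge> 0" "\<And>m. (\<Sum>n=1..<m. real n powr (\<beta> - 1)) \<le> C * real m powr \<beta>"
    using powr_partial_sum_bound[OF assms] by blast
  have "(\<Sum>n<T. rising_binomial \<beta> n) \<le> (1 + M * C) * real T powr \<beta>" if T: "T \<ge> 1" for T
  proof -
    \<comment> \<open>The term at 0 equals 1 and is split off, since the bound
      \<open>M * n powr (\<beta> - 1)\<close> holds only from 1 on;
      \<open>T powr \<beta> \<ge> 1\<close> absorbs it.\<close>
    have "(\<Sum>n<T. rising_binomial \<beta> n) = rising_binomial \<beta> 0 + (\<Sum>n=1..<T. rising_binomial \<beta> n)"
      using T by (simp add: lessThan_atLeast0 sum.atLeast_Suc_lessThan)
    also have "\<dots> \<le> real T powr \<beta> + (\<Sum>n=1..<T. M * real n powr (\<beta> - 1))"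
      using T assms M(2) ge_one_powr_ge_zero[of "real T" \<beta>]
      by (intro add_mono sum_mono) (auto simp: rising_binomial_def)
    also have "\<dots> \<le> real T powr \<beta> + M * (C * real T powr \<beta>)"
      using M(1) C(2)[of T] by (auto simp flip: sum_distrib_left intro: mult_left_mono)
    finally show ?thesis by (simp add: algebra_simps)
  qed
  then show ?thesis using M(1) C(1) by (intro that[of "1 + M * C"]) (auto intro: add_pos_nonneg)
qed

text \<open>Euler's integral after the substitution \<open>D * t\<close>. The nonnegative integral
  is used because it can be exchanged with a series before integrability is known.\<close>

lemma nn_integral_gamma_scaled:
  fixes D s :: real
  assumes "D > 0" "s > 0"
  shows "(\<integral>\<^sup>+t. ennreal (indicator {0<..} t * (t powr (s - 1) * exp (- (t * D)))) \<partial>lborel) =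
    ennreal (Gamma s / D powr s)" (is "?I = _")
proof -
  have "ennreal (Gamma s) = (\<integral>\<^sup>+t. ennreal (indicator {0..} t * t powr (s - 1) / exp t) \<partial>lborel)"
    by (rule Gamma_conv_nn_integral_real) fact
  also have "\<dots> = ennreal \<bar>D\<bar> *
      (\<integral>\<^sup>+t. ennreal (indicator {0..} (0 + D * t) * (0 + D * t) powr (s - 1) / exp (0 + D * t)) \<partial>lborel)"
    using assms by (intro nn_integral_real_affine) auto
  also have "(\<integral>\<^sup>+t. ennreal (indicator {0..} (0 + D * t) * (0 + D * t) powr (s - 1) / exp (0 + D * t)) \<partial>lborel)
      = (\<integral>\<^sup>+t. ennreal (D powr (s - 1)) *
          ennreal (indicator {0<..} t * (t powr (s - 1) * exp (- (t * D)))) \<partial>lborel)"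
  proof (intro nn_integral_cong)
    fix t :: real
    show "ennreal (indicator {0..} (0 + D * t) * (0 + D * t) powr (s - 1) / exp (0 + D * t)) =
        ennreal (D powr (s - 1)) * ennreal (indicator {0<..} t * (t powr (s - 1) * exp (- (t * D))))"
      using assms
      by (cases "t > 0")
        (auto simp: indicator_def powr_mult exp_minus field_simps zero_le_mult_iff simp flip: ennreal_mult)
  qed
  also have "\<dots> = ennreal (D powr (s - 1)) * ?I"
    by (rule nn_integral_cmult) simp
  finally have "ennreal (Gamma s) = ennreal (D powr s) * ?I"
    using assms by (simp add: mult.assoc[symmetric] powr_diff flip: ennreal_mult)
  then have "ennreal (1 / D powr s) * ennreal (Gamma s) = (ennreal (1 / D powr s) * ennreal (D powr s)) * ?I"
    by (simp add: mult.assoc)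
  also have "ennreal (1 / D powr s) * ennreal (D powr s) = 1"
    using assms by (simp flip: ennreal_mult)
  finally show ?thesis
    using assms Gamma_real_pos[of s] by (simp flip: ennreal_mult)
qed

lemma lp_norm_nonneg: "lp_norm A p f \<ge> 0"
  by (simp add: lp_norm_def)

section \<open>The averaging operator and the heat kernel\<close>

locale cayley_graph = group G for G (structure) +
  fixes S :: "'a set"
  assumes gen: "symmetric_generating_set G S"
begin

lemma finite_S: "finite S" and S_carrier: "S \<subseteq> carrier G"
  and S_inv_image: "(\<lambda>s. inv s) ` S = S" and S_generate: "generate G S = carrier G"
  using gen by (auto simp: symmetric_generating_set_def)

lemma S_closed [simp]: "s \<in> S \<Longrightarrow> s \<in> carrier G"
  using S_carrier by auto

lemma S_inv: "s \<in> S \<Longrightarrow> inv s \<in> S"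
  using S_inv_image by blast

lemma bij_mult_right: "w \<in> carrier G \<Longrightarrow> bij_betw (\<lambda>x. x \<otimes> w) (carrier G) (carrier G)"
  by (rule bij_betwI[where g = "\<lambda>x. x \<otimes> inv w"]) (auto simp: m_assoc)

lemma bij_mult_left: "w \<in> carrier G \<Longrightarrow> bij_betw (\<lambda>x. w \<otimes> x) (carrier G) (carrier G)"
  by (rule bij_betwI[where g = "\<lambda>x. inv w \<otimes> x"]) (auto simp: m_assoc[symmetric])

lemma sum_S_inv: "(\<Sum>s\<in>S. f (inv s)) = (\<Sum>s\<in>S. f s)"
  by (rule sum.reindex_bij_witness[of _ "\<lambda>s. inv s" "\<lambda>s. inv s"]) (auto simp: S_inv)

definition walk :: "('a \<Rightarrow> real) \<Rightarrow> 'a \<Rightarrow> real" where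
  "walk f x = (\<Sum>s\<in>S. f (x \<otimes> s)) / real (card S)"

text \<open>The matrix entries of the powers of \<open>walk\<close>: for nonempty \<open>S\<close>,
  the transition probabilities of the simple random walk on the carrier.\<close>

definition step :: "nat \<Rightarrow> 'a \<Rightarrow> 'a \<Rightarrow> real" where
  "step n x y = (walk ^^ n) (indicator {y}) x"

text \<open>Functions live on the whole type, but only their values on the carrier enter, because it
  is closed under multiplication by generators.\<close>

lemma walk_cong: "(\<And>y. y \<in> carrier G \<Longrightarrow> f y = g y) \<Longrightarrow> x \<in> carrier G \<Longrightarrow> walk f x = walk g x"
  unfolding walk_def by (intro arg_cong2[where f = "(/)"] sum.cong) auto

lemma walk_pow_cong:
  "(\<And>y. y \<in> carrier G \<Longrightarrow> f y = g y) \<Longrightarrow> x \<in> carrier G \<Longrightarrow> (walk ^^ n) f x = (walk ^^ n) g x"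
  by (induction n arbitrary: x) (auto intro: walk_cong)

lemma walk_mono: "(\<And>y. y \<in> carrier G \<Longrightarrow> f y \<le> g y) \<Longrightarrow> x \<in> carrier G \<Longrightarrow> walk f x \<le> walk g x"
  unfolding walk_def by (intro divide_right_mono sum_mono) auto

lemma walk_pow_mono:
  "(\<And>y. y \<in> carrier G \<Longrightarrow> f y \<le> g y) \<Longrightarrow> x \<in> carrier G \<Longrightarrow> (walk ^^ n) f x \<le> (walk ^^ n) g x"
  by (induction n arbitrary: x) (auto intro: walk_mono)

lemma walk_pow_zero: "(walk ^^ n) (\<lambda>x. 0) = (\<lambda>x. 0)"
  by (induction n) (auto simp: walk_def)

lemma walk_pow_nonneg:
  "(\<And>y. y \<in> carrier G \<Longrightarrow> 0 \<le> f y) \<Longrightarrow> x \<in> carrier G \<Longrightarrow> 0 \<le> (walk ^^ n) f x"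
  using walk_pow_mono[of "\<lambda>x. 0" f x n] by (simp add: walk_pow_zero)

lemma walk_pow_add: "(walk ^^ n) (\<lambda>y. f y + g y) = (\<lambda>x. (walk ^^ n) f x + (walk ^^ n) g x)"
  by (induction n) (auto simp: walk_def sum.distrib add_divide_distrib)

lemma walk_pow_cmult: "(walk ^^ n) (\<lambda>y. c * f y) = (\<lambda>x. c * (walk ^^ n) f x)"
  by (induction n) (auto simp: walk_def sum_distrib_left)

lemma walk_pow_sum: "(walk ^^ n) (\<lambda>y. \<Sum>i\<in>I. f i y) = (\<lambda>x. \<Sum>i\<in>I. (walk ^^ n) (f i) x)"
  by (induction I rule: infinite_finite_induct) (auto simp: walk_pow_zero walk_pow_add)

text \<open>An inequality rather than an equation, because for empty \<open>S\<close> the average is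
  0 by division by zero.\<close>

lemma walk_pow_const_le: "c \<ge> 0 \<Longrightarrow> (walk ^^ n) (\<lambda>y. c) x \<le> c"
proof (induction n arbitrary: x)
  case (Suc n)
  have "walk ((walk ^^ n) (\<lambda>y. c)) x \<le> (\<Sum>s\<in>S. c) / real (card S)"
    unfolding walk_def[of "(walk ^^ n) (\<lambda>y. c)"] using Suc by (intro divide_right_mono sum_mono) auto
  also have "\<dots> \<le> c" using Suc.prems by simp
  finally show ?case by simp
qed simp

lemma step_nonneg: "x \<in> carrier G \<Longrightarrow> 0 \<le> step n x y"
  unfolding step_def by (rule walk_pow_nonneg) auto

lemma step_le_1: "x \<in> carrier G \<Longrightarrow> step n x y \<le> 1"
  unfolding step_def
  by (rule order_trans[OF walk_pow_mono[where g = "\<lambda>_. 1"] walk_pow_const_le]) (auto simp: indicator_def)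

lemma step_Suc: "step (Suc n) x y = (\<Sum>s\<in>S. step n (x \<otimes> s) y) / real (card S)"
  by (simp add: step_def walk_def)

text \<open>The base case has a single nonzero term, and each further step is a finite average of
  convergent sums; hence convergence for arbitrary \<open>f\<close>.\<close>

lemma walk_pow_has_sum:
  assumes "x \<in> carrier G"
  shows "((\<lambda>y. step n x y * f y) has_sum (walk ^^ n) f x) (carrier G)"
  using assms
proof (induction n arbitrary: x)
  case 0
  show ?case
    by (rule has_sum_finite_neutralI[of "{x}"]) (use 0 in \<open>auto simp: step_def\<close>)
next
  case (Suc n)
  have "((\<lambda>y. \<Sum>s\<in>S. step n (x \<otimes> s) y * f y) has_sum (\<Sum>s\<in>S. (walk ^^ n) f (x \<otimes> s))) (carrier G)"
    using Suc by (intro has_sum_finite_sum) auto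
  from has_sum_cmult_right[OF this, of "1 / real (card S)"]
  show ?case
    by (simp add: step_Suc walk_def[of "(walk ^^ n) f" x] sum_distrib_right sum_divide_distrib)
qed

text \<open>Reversibility. The inductive step moves one averaging to the inside, where it spreads
  the unit mass at \<open>x\<close> over the points \<open>x \<otimes> inv s\<close>; as
  \<open>S\<close> is symmetric, these are the points \<open>x \<otimes> s\<close>.\<close>

lemma step_sym:
  assumes "x \<in> carrier G" "y \<in> carrier G"
  shows "step n x y = step n y x"
  using assms
proof (induction n arbitrary: x)
  case 0
  then show ?case by (auto simp: step_def indicator_def)
next
  case (Suc n)
  have "step (Suc n) y x = (walk ^^ n) (walk (indicator {x})) y"
    by (simp add: step_def funpow_Suc_right del: funpow.simps)
  also have "\<dots> = (walk ^^ n) (\<lambda>z. (1 / real (card S)) * (\<Sum>s\<in>S. indicator {x \<otimes> s} z)) y"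
  proof (rule walk_pow_cong)
    fix z assume z: "z \<in> carrier G"
    have "(\<Sum>s\<in>S. indicator {x} (z \<otimes> s)) = (\<Sum>s\<in>S. indicator {x \<otimes> inv s} z :: real)"
      using z Suc.prems
      by (intro sum.cong) (auto simp: indicator_def m_assoc)
    also have "\<dots> = (\<Sum>s\<in>S. indicator {x \<otimes> s} z)"
      by (rule sum_S_inv)
    finally show "walk (indicator {x}) z = (1 / real (card S)) * (\<Sum>s\<in>S. indicator {x \<otimes> s} z)"
      by (simp add: walk_def)
  qed (use Suc in auto)
  also have "\<dots> = (\<Sum>s\<in>S. step n y (x \<otimes> s)) / real (card S)"
    by (simp only: walk_pow_cmult walk_pow_sum step_def) simp
  also have "\<dots> = (\<Sum>s\<in>S. step n (x \<otimes> s) y) / real (card S)"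
    using Suc by (intro arg_cong2[where f = "(/)"] sum.cong) auto
  finally show ?case unfolding step_Suc[of n x y] by (rule sym)
qed

text \<open>Left translation commutes with right multiplication by generators.\<close>

lemma step_translate:
  assumes "x \<in> carrier G" "y \<in> carrier G" "w \<in> carrier G"
  shows "step n (w \<otimes> x) (w \<otimes> y) = step n x y"
  using assms(1)
proof (induction n arbitrary: x)
  case 0
  then show ?case using assms by (auto simp: step_def indicator_def)
next
  case (Suc n)
  then show ?case using assms by (simp add: step_Suc m_assoc)
qed

lemma step_eq_step_one:
  assumes "x \<in> carrier G" "y \<in> carrier G"
  shows "step n x y = step n (inv y \<otimes> x) \<one>"
  using step_translate[of x y "inv y" n] assms by simp

section \<open>The Laplacian, the heat kernel and the Green's function in terms of the walk\<close>

lemma laplacian_eq: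
  assumes "x \<in> carrier G"
  shows "laplacian G S u x = real (card S) * (walk u x - u x)"
proof -
  have "{y. (y, x) \<in> cayley_adj G S} = (\<lambda>s. x \<otimes> s) ` S"
    using assms by (auto simp: cayley_adj_def)
  moreover have "inj_on (\<lambda>s. x \<otimes> s) S"
    using assms by (auto simp: inj_on_def)
  ultimately have "laplacian G S u x = (\<Sum>s\<in>S. u (x \<otimes> s) - u x)"
    by (simp add: laplacian_def sum.reindex)
  then show ?thesis
    using finite_S by (cases "S = {}") (auto simp: walk_def sum_subtractf algebra_simps)
qed

text \<open>The binomial theorem for \<open>D * (walk - id)\<close>, done with Pascal's rule on the
  coefficients because \<open>laplacian_eq\<close> holds only at points of the carrier.\<close>

lemma laplacian_pow_binomial:
  assumes "x \<in> carrier G"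
  shows "(laplacian G S ^^ n) u x =
    real (card S) ^ n * (\<Sum>k\<le>n. real (n choose k) * (- 1) ^ (n - k) * (walk ^^ k) u x)"
  using assms
proof (induction n arbitrary: x)
  case (Suc n)
  let ?D = "real (card S)"
  let ?a = "\<lambda>k. (walk ^^ k) u x"
  have "walk ((laplacian G S ^^ n) u) x =
      walk (\<lambda>y. ?D ^ n * (\<Sum>k\<le>n. real (n choose k) * (- 1) ^ (n - k) * (walk ^^ k) u y)) x"
    using Suc by (intro walk_cong) auto
  also have "\<dots> = ?D ^ n * (\<Sum>k\<le>n. real (n choose k) * (- 1) ^ (n - k) * ?a (Suc k))"
    by (simp only: walk_pow_cmult[of 1, simplified] walk_pow_sum[of 1, simplified]) simp
  finally have w: "walk ((laplacian G S ^^ n) u) x =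
      ?D ^ n * (\<Sum>k\<le>n. real (n choose k) * (- 1) ^ (n - k) * ?a (Suc k))" .
  have "(\<Sum>k\<le>Suc n. real (Suc n choose k) * (- 1) ^ (Suc n - k) * ?a k) =
      (- 1) ^ Suc n * ?a 0 +
      (\<Sum>k\<le>n. real (n choose k) * (- 1) ^ (n - k) * ?a (Suc k)) +
      (\<Sum>k\<le>n. real (n choose Suc k) * (- 1) ^ (n - k) * ?a (Suc k))"
    by (subst sum.atMost_Suc_shift) (simp add: sum.distrib algebra_simps)
  \<comment> \<open>An index shift: the top term vanishes since \<open>n choose Suc n = 0\<close>,
    and the missing term with \<open>?a 0\<close> is added back. For \<open>n = 0\<close> nothing is
    left to shift.\<close>
  also have "(\<Sum>k\<le>n. real (n choose Suc k) * (- 1) ^ (n - k) * ?a (Suc k)) =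
      - (\<Sum>k\<le>n. real (n choose k) * (- 1) ^ (n - k) * ?a k) + (- 1) ^ n * ?a 0"
  proof (cases n)
    case (Suc m)
    have "(\<Sum>k\<le>Suc m. real (Suc m choose Suc k) * (- 1) ^ (Suc m - k) * ?a (Suc k)) =
        (\<Sum>k\<le>m. real (Suc m choose Suc k) * (- 1) ^ (Suc m - k) * ?a (Suc k))"
      by (simp only: sum.atMost_Suc) (simp add: binomial_eq_0 del: binomial_Suc_Suc)
    also have "\<dots> = - (\<Sum>k\<le>m. real (Suc m choose Suc k) * (- 1) ^ (m - k) * ?a (Suc k))"
      by (subst sum_negf[symmetric]) (intro sum.cong, auto simp: Suc_diff_le simp del: binomial_Suc_Suc)
    also have "(\<Sum>k\<le>m. real (Suc m choose Suc k) * (- 1) ^ (m - k) * ?a (Suc k)) =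
        (\<Sum>k\<le>Suc m. real (Suc m choose k) * (- 1) ^ (Suc m - k) * ?a k) - (- 1) ^ Suc m * ?a 0"
      by (simp add: sum.atMost_Suc_shift del: binomial_Suc_Suc sum.atMost_Suc funpow.simps)
    finally show ?thesis unfolding Suc by simp
  qed simp
  finally have b: "(\<Sum>k\<le>Suc n. real (Suc n choose k) * (- 1) ^ (Suc n - k) * ?a k) =
      (\<Sum>k\<le>n. real (n choose k) * (- 1) ^ (n - k) * ?a (Suc k)) -
      (\<Sum>k\<le>n. real (n choose k) * (- 1) ^ (n - k) * ?a k)"
    by simp
  have "(laplacian G S ^^ Suc n) u x =
      ?D * (walk ((laplacian G S ^^ n) u) x - (laplacian G S ^^ n) u x)"
    using Suc.prems by (simp add: laplacian_eq)
  also have "\<dots> = ?D ^ Suc n * ((\<Sum>k\<le>n. real (n choose k) * (- 1) ^ (n - k) * ?a (Suc k)) -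
      (\<Sum>k\<le>n. real (n choose k) * (- 1) ^ (n - k) * ?a k))"
    unfolding w Suc.IH[OF Suc.prems] power_Suc right_diff_distrib mult.assoc by (rule refl)
  finally show ?case unfolding b .
qed simp

text \<open>Since \<open>\<Delta> = D (P - 1)\<close>, the semigroup is \<open>exp (- t D)\<close>
  times the exponential of \<open>t D P\<close>; for \<open>t \<ge> 0\<close> the number of steps
  made by time \<open>t\<close> is Poisson distributed.\<close>

lemma heat_kernel_eq:
  assumes "x \<in> carrier G"
  defines "D \<equiv> real (card S)"
  shows "(\<lambda>n. (t * D) ^ n / fact n * step n x y) sums (exp (t * D) * heat_kernel G S t x y)"
proof -
  let ?u = "indicator {y} :: 'a \<Rightarrow> real"
  define a where "a n = (t * D) ^ n / fact n * step n x y" for n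
  define b where "b n = (- (t * D)) ^ n /\<^sub>R fact n" for n
  have sb: "summable (\<lambda>n. norm (b n))"
    unfolding b_def by (rule summable_norm_exp)
  have sa: "summable (\<lambda>n. norm (a n))"
  proof (rule summable_comparison_test'[OF summable_norm_exp[of "t * D"], of 0])
    fix n
    have "\<bar>step n x y\<bar> \<le> 1" using step_nonneg[OF assms(1)] step_le_1[OF assms(1)] by simp
    then have "\<bar>(t * D) ^ n / fact n\<bar> * \<bar>step n x y\<bar> \<le> \<bar>(t * D) ^ n / fact n\<bar> * 1"
      by (intro mult_left_mono) auto
    then show "norm (norm (a n)) \<le> norm ((t * D) ^ n /\<^sub>R fact n)"
      by (simp add: a_def abs_mult divide_inverse mult_ac)
  qed
  \<comment> \<open>Multiplying by the series of \<open>exp (- (t * D))\<close> reproduces the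
    defining series of the heat semigroup, term by term, through the binomial formula.\<close>
  have "(\<lambda>k. \<Sum>i\<le>k. a i * b (k - i)) sums ((\<Sum>k. a k) * (\<Sum>k. b k))"
    by (rule Cauchy_product_sums[OF sa sb])
  also have "(\<lambda>k. \<Sum>i\<le>k. a i * b (k - i)) = (\<lambda>n. t ^ n / fact n * (laplacian G S ^^ n) ?u x)"
  proof
    fix n
    have "t ^ n / fact n * (laplacian G S ^^ n) ?u x =
        (\<Sum>k\<le>n. t ^ n / fact n * (D ^ n * (real (n choose k) * (- 1) ^ (n - k) * step k x y)))"
      using assms(1) by (simp add: laplacian_pow_binomial D_def step_def sum_distrib_left)
    also have "\<dots> = (\<Sum>i\<le>n. a i * b (n - i))"
    proof (intro sum.cong refl)
      fix k assume k: "k \<in> {..n}"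
      have p: "(t * D) ^ n = (t * D) ^ k * (t * D) ^ (n - k)"
        using k by (simp flip: power_add)
      have "(- (t * D)) ^ (n - k) = (- 1) ^ (n - k) * (t * D) ^ (n - k)"
        by (rule power_minus)
      then have "a k * b (n - k) = ((t * D) ^ k * (t * D) ^ (n - k)) * ((- 1) ^ (n - k) * step k x y)
          / (fact k * fact (n - k))"
        by (simp add: a_def b_def field_simps)
      also have "\<dots> = t ^ n / fact n * (D ^ n * (real (n choose k) * (- 1) ^ (n - k) * step k x y))"
      proof -
        have "real (n choose k) = fact n / (fact k * fact (n - k))"
          using k by (simp add: binomial_fact)
        then show ?thesis
          by (simp add: p[symmetric] power_mult_distrib del: power_mult_distrib)
            (simp add: power_mult_distrib)
      qed
      finally show "t ^ n / fact n * (D ^ n * (real (n choose k) * (- 1) ^ (n - k) * step k x y)) =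
          a k * b (n - k)" by simp
    qed
    finally show "(\<Sum>i\<le>n. a i * b (n - i)) = t ^ n / fact n * (laplacian G S ^^ n) ?u x" by simp
  qed
  finally have "(\<Sum>k. a k) * (\<Sum>k. b k) = heat_kernel G S t x y"
    unfolding heat_kernel_def heat_semigroup_def by (rule sums_unique)
  moreover have "(\<Sum>k. b k) = exp (- (t * D))"
    by (simp add: b_def exp_def)
  ultimately have "(\<Sum>k. a k) = exp (t * D) * heat_kernel G S t x y"
    by (simp add: exp_minus field_simps)
  moreover have "a sums (\<Sum>k. a k)"
    using summable_norm_cancel[OF sa] by (rule summable_sums)
  ultimately show ?thesis unfolding a_def by simp
qed

text \<open>The Poisson weights are integrated against \<open>t powr (\<beta> - 1)\<close> term by
  term. The resulting \<open>Gamma (n + \<beta>)\<close> equals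
  \<open>pochhammer \<beta> n * Gamma \<beta>\<close>, and \<open>Gamma \<beta>\<close> cancels with
  the normalization of \<open>green\<close>.\<close>

lemma green_eq:
  assumes x: "x \<in> carrier G" and S: "S \<noteq> {}" and \<alpha>: "\<alpha> > 0"
    and sm: "summable (\<lambda>n. pochhammer (\<alpha> / 2) n / fact n * step n x y)"
  shows "set_integrable lborel {0<..} (\<lambda>t. heat_kernel G S t x y * t powr (-1 + \<alpha> / 2))" (is ?A)
    and "green G S \<alpha> x y =
      real (card S) powr - (\<alpha> / 2) * (\<Sum>n. pochhammer (\<alpha> / 2) n / fact n * step n x y)" (is ?B)
proof -
  define D where "D = real (card S)"
  have D: "D > 0" using S finite_S by (simp add: D_def card_gt_0_iff)
  define \<beta> where "\<beta> = \<alpha> / 2"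
  have \<beta>: "\<beta> > 0" using \<alpha> by (simp add: \<beta>_def)
  define c where "c n = pochhammer \<beta> n / fact n * step n x y" for n
  define V where "V = D powr - \<beta> * Gamma \<beta> * (\<Sum>n. c n)"
  define h where "h t = indicator {0<..} t * (heat_kernel G S t x y * t powr (-1 + \<beta>))" for t :: real
  define g where "g n t = (D ^ n / fact n * step n x y) *
      (indicator {0<..} t * (t powr (real n + \<beta> - 1) * exp (- (t * D))))" for n and t :: real
  have p: "step n x y \<ge> 0" for n by (rule step_nonneg[OF x])
  have c: "c n \<ge> 0" for n
    using p \<beta> by (simp add: c_def pochhammer_nonneg)
  have g: "g n t \<ge> 0" for n t
    using p D by (simp add: g_def)
  have gs: "(\<lambda>n. g n t) sums h t" for t
  proof (cases "t > 0")
    case True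
    have "(\<lambda>n. (exp (- (t * D)) * t powr (- 1 + \<beta>)) * ((t * D) ^ n / fact n * step n x y)) sums
        ((exp (- (t * D)) * t powr (- 1 + \<beta>)) * (exp (t * D) * heat_kernel G S t x y))"
      using heat_kernel_eq[OF x, of t y] unfolding D_def by (rule sums_mult)
    also have "(exp (- (t * D)) * t powr (- 1 + \<beta>)) * (exp (t * D) * heat_kernel G S t x y) = h t"
      using True by (simp add: h_def exp_minus)
    also have "(\<lambda>n. (exp (- (t * D)) * t powr (- 1 + \<beta>)) * ((t * D) ^ n / fact n * step n x y)) = (\<lambda>n. g n t)"
    proof
      fix n
      have "t powr (real n + \<beta> - 1) = t ^ n * t powr (- 1 + \<beta>)"
        using True powr_add[of t "real n" "- 1 + \<beta>"] by (simp add: powr_realpow algebra_simps)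
      then show "(exp (- (t * D)) * t powr (- 1 + \<beta>)) * ((t * D) ^ n / fact n * step n x y) = g n t"
        using True by (simp add: g_def power_mult_distrib)
    qed
    finally show ?thesis .
  qed (simp add: g_def h_def)
  have gm [measurable]: "g n \<in> borel_measurable lborel" for n
    unfolding g_def by measurable
  \<comment> \<open>As a limit of measurable partial sums, \<open>h\<close> is measurable in
    \<open>t\<close>.\<close>
  have h: "h = (\<lambda>t. \<Sum>n. g n t)"
    using gs by (auto simp: sums_iff fun_eq_iff)
  have hm: "h \<in> borel_measurable lborel"
    unfolding h by measurable
  have h0: "h t \<ge> 0" for t
    using sums_le[OF _ sums_zero gs[of t]] g by auto
  have V0: "V \<ge> 0"
    using c sm \<beta> unfolding V_def
    by (intro mult_nonneg_nonneg suminf_nonneg) (auto simp: c_def[abs_def] \<beta>_def intro: Gamma_real_pos[THEN less_imp_le])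
  \<comment> \<open>All terms are nonnegative, so sum and integral may be exchanged. The finite
    value \<open>V\<close> then yields Bochner integrability.\<close>
  have "(\<integral>\<^sup>+t. ennreal (h t) \<partial>lborel) = (\<integral>\<^sup>+t. (\<Sum>n. ennreal (g n t)) \<partial>lborel)"
    by (intro nn_integral_cong suminf_ennreal_eq[symmetric] g gs)
  also have "\<dots> = (\<Sum>n. \<integral>\<^sup>+t. ennreal (g n t) \<partial>lborel)"
    by (rule nn_integral_suminf) measurable
  also have "\<dots> = (\<Sum>n. ennreal (D powr - \<beta> * Gamma \<beta> * c n))"
  proof (intro suminf_cong)
    fix n
    have "(\<integral>\<^sup>+t. ennreal (g n t) \<partial>lborel) = ennreal (D ^ n / fact n * step n x y) *
        (\<integral>\<^sup>+t. ennreal (indicator {0<..} t * (t powr (real n + \<beta> - 1) * exp (- (t * D)))) \<partial>lborel)"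
      unfolding g_def using p[of n] D
      by (subst ennreal_mult) (auto intro: nn_integral_cmult)
    also have "\<dots> = ennreal (D ^ n / fact n * step n x y * (Gamma (real n + \<beta>) / D powr (real n + \<beta>)))"
      using D \<beta> p[of n] Gamma_real_pos[of "real n + \<beta>"]
      by (subst nn_integral_gamma_scaled) (auto simp: ennreal_mult[symmetric])
    also have "D ^ n / fact n * step n x y * (Gamma (real n + \<beta>) / D powr (real n + \<beta>)) =
        D powr - \<beta> * Gamma \<beta> * c n"
    proof -
      have "\<beta> \<notin> \<int>\<^sub>\<le>\<^sub>0" using \<beta> by (auto elim!: nonpos_Ints_cases)
      then have "Gamma (real n + \<beta>) = pochhammer \<beta> n * Gamma \<beta>"
        using pochhammer_Gamma[of \<beta> n] Gamma_real_pos[OF \<beta>, THEN less_imp_neq]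
        by (simp add: add.commute field_simps)
      then show ?thesis
        using D by (simp add: c_def powr_add powr_realpow powr_minus field_simps)
    qed
    finally show "(\<integral>\<^sup>+t. ennreal (g n t) \<partial>lborel) = ennreal (D powr - \<beta> * Gamma \<beta> * c n)" .
  qed
  also have "\<dots> = ennreal V"
  proof (rule suminf_ennreal_eq)
    show "(\<lambda>n. D powr - \<beta> * Gamma \<beta> * c n) sums V"
      using sm unfolding V_def c_def \<beta>_def by (intro sums_mult summable_sums)
    show "0 \<le> D powr - \<beta> * Gamma \<beta> * c n" for n
      using c[of n] \<beta> Gamma_real_pos[of \<beta>] by simp
  qed
  finally have hb: "has_bochner_integral lborel h V"
    using hm h0 V0 by (intro has_bochner_integral_nn_integral) auto
  show ?A
    using hb by (auto simp: set_integrable_def h_def[abs_def] \<beta>_def has_bochner_integral_iff)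
  have "(LBINT t:{0<..}. heat_kernel G S t x y * t powr (-1 + \<alpha> / 2)) = V"
    using hb by (auto simp: set_lebesgue_integral_def h_def[abs_def] \<beta>_def has_bochner_integral_iff)
  then show ?B
    using Gamma_real_pos[OF \<beta>, THEN less_imp_neq] by (simp add: green_def V_def c_def D_def \<beta>_def)
qed

section \<open>Decay of the return probabilities\<close>

primrec words :: "nat \<Rightarrow> 'a set" where
  "words 0 = {\<one>}"
| "words (Suc n) = (\<Union>s\<in>S. (\<lambda>x. x \<otimes> s) ` words n)"

lemma words_carrier: "words n \<subseteq> carrier G"
  by (induction n) auto

lemma finite_words: "finite (words n)"
  by (induction n) (auto intro: finite_S)

lemma words_mult: "x \<in> words m \<Longrightarrow> y \<in> words n \<Longrightarrow> x \<otimes> y \<in> words (m + n)"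
proof (induction n arbitrary: y)
  case 0
  then show ?case using words_carrier[of m] by auto
next
  case (Suc n)
  then obtain z s where z: "z \<in> words n" "s \<in> S" "y = z \<otimes> s" by auto
  then have "x \<otimes> y = (x \<otimes> z) \<otimes> s"
    using Suc.prems words_carrier by (auto simp: m_assoc subset_iff)
  then show ?case using Suc z by auto
qed

lemma words_one: "s \<in> S \<Longrightarrow> s \<in> words 1"
  by auto

text \<open>Inverses of generators are generators, so every element of the generated group is a
  word. Hence the minimum in \<open>cayley_dist\<close> is attained.\<close>

lemma ex_words: "x \<in> carrier G \<Longrightarrow> \<exists>m. x \<in> words m"
proof -
  assume "x \<in> carrier G"
  then have "x \<in> generate G S" by (simp add: S_generate)
  then show ?thesis
  proof (induction rule: generate.induct)
    case one
    have "\<one> \<in> words 0" by simp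
    then show ?case by blast
  next
    case (incl h)
    then show ?case using words_one by blast
  next
    case (inv h)
    then show ?case using words_one S_inv by blast
  next
    case (eng h1 h2)
    then show ?case using words_mult by blast
  qed
qed

text \<open>Appending the generator \<open>s\<close> to a word corresponds to an edge given by
  \<open>inv s\<close>, which is again in \<open>S\<close>.\<close>

lemma words_iff_relpow: "x \<in> words m \<longleftrightarrow> (\<one>, x) \<in> cayley_adj G S ^^ m"
proof (induction m arbitrary: x)
  case (Suc m)
  show ?case
  proof
    assume "x \<in> words (Suc m)"
    then obtain s y where y: "s \<in> S" "y \<in> words m" "x = y \<otimes> s" by auto
    then have "y \<in> carrier G" using words_carrier by auto
    then have "(y, x) \<in> cayley_adj G S"
      using y by (auto simp: cayley_adj_def m_assoc intro!: bexI[of _ "inv s"] S_inv)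
    then show "(\<one>, x) \<in> cayley_adj G S ^^ Suc m"
      using Suc y by auto
  next
    assume "(\<one>, x) \<in> cayley_adj G S ^^ Suc m"
    then obtain y where y: "y \<in> words m" "(y, x) \<in> cayley_adj G S"
      using Suc by auto
    then obtain s where s: "s \<in> S" "y = x \<otimes> s" "x \<in> carrier G" by (auto simp: cayley_adj_def)
    then have "x = y \<otimes> inv s" by (simp add: m_assoc)
    then show "x \<in> words (Suc m)" using y s S_inv by auto
  qed
qed auto

text \<open>Appending \<open>s\<close> and \<open>inv s\<close> prolongs a word by two letters. One
  letter need not be possible: in a bipartite Cayley graph words of different parity represent
  different elements.\<close>

lemma words_add_even:
  assumes "S \<noteq> {}"
  shows "words m \<subseteq> words (m + 2 * k)"
proof (induction k)
  case (Suc k)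
  obtain s where s: "s \<in> S" using assms by auto
  have "\<one> \<in> words 2"
    using words_mult[OF words_one[OF s] words_one[OF S_inv[OF s]]] s by (simp add: numeral_2_eq_2)
  then have "x \<in> words (m + 2 * k + 2)" if "x \<in> words (m + 2 * k)" for x
    using words_mult[OF that, of \<one> 2] that words_carrier[of "m + 2 * k"]
    by (simp del: words.simps add: subset_iff)
  then show ?case using Suc by (simp add: subset_iff del: words.simps)
qed simp

text \<open>Right multiplication by one fixed generator is an injection. Only cardinalities are
  compared, as the two sets may be disjoint.\<close>

lemma card_words_mono:
  assumes "S \<noteq> {}"
  shows "card (words n) \<le> card (words (Suc n))"
proof -
  obtain s where s: "s \<in> S" using assms by auto
  have "inj_on (\<lambda>x. x \<otimes> s) (words n)"
    using bij_mult_right[of s] s words_carrier[of n] by (auto simp: bij_betw_def intro: inj_on_subset)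
  then have "card (words n) = card ((\<lambda>x. x \<otimes> s) ` words n)"
    by (simp add: card_image)
  also have "\<dots> \<le> card (words (Suc n))"
    using s by (intro card_mono finite_words) auto
  finally show ?thesis .
qed

text \<open>An element at distance \<open>m \<le> n\<close> is a word of length \<open>m\<close>,
  and \<open>m\<close> has the parity of \<open>n\<close> or of \<open>Suc n\<close>, so padding by
  pairs reaches one of these two lengths.\<close>

lemma growth_le_card_words:
  assumes "S \<noteq> {}"
  shows "growth G S n \<le> 2 * card (words (Suc n))"
proof -
  have "{x \<in> carrier G. cayley_dist G S \<one> x \<le> n} \<subseteq> words n \<union> words (Suc n)"
  proof
    fix x assume x: "x \<in> {x \<in> carrier G. cayley_dist G S \<one> x \<le> n}"
    define m where "m = cayley_dist G S \<one> x"
    have "\<exists>m. (\<one>, x) \<in> cayley_adj G S ^^ m"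
      using ex_words[of x] x by (simp add: words_iff_relpow)
    then have "x \<in> words m"
      unfolding m_def cayley_dist_def words_iff_relpow by (rule LeastI_ex)
    moreover have "m \<le> n" using x by (simp add: m_def)
    then have "n = m + 2 * ((n - m) div 2) \<or> Suc n = m + 2 * (Suc (n - m) div 2)"
      by presburger
    ultimately show "x \<in> words n \<union> words (Suc n)"
      using words_add_even[OF assms, of m] by (metis UnCI subsetD)
  qed
  then have "growth G S n \<le> card (words n \<union> words (Suc n))"
    unfolding growth_def by (intro card_mono) (auto simp: finite_words simp del: words.simps)
  also have "\<dots> \<le> card (words n) + card (words (Suc n))"
    by (rule card_Un_le)
  finally show ?thesis using card_words_mono[OF assms, of n] by linarith
qed

lemma polynomial_growth_words:
  assumes "polynomial_growth G S N" "N \<ge> 1"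
  shows "S \<noteq> {}"
    and "\<exists>c>0. \<forall>n\<ge>1. c * real n ^ N \<le> real (card (words (2 * n)))"
proof -
  obtain C where C: "C > 0" "\<And>n. n \<ge> 1 \<Longrightarrow> C * real n ^ N \<le> real (growth G S n)"
    using assms by (auto simp: polynomial_growth_def)
  show S: "S \<noteq> {}"
  proof
    assume "S = {}"
    then have "carrier G = {\<one>}"
      using S_generate generate_empty by simp
    then have g: "growth G S n \<le> 1" for n
      unfolding growth_def by (metis (no_types, lifting) card_mono card.empty card.insert empty_iff finite.emptyI finite_insert mem_Collect_eq One_nat_def subsetI)
    \<comment> \<open>Large enough for \<open>C * n > 2\<close>, while balls in the trivial group
      have at most one element.\<close>
    define n where "n = nat \<lceil>2 / C\<rceil> + 1"
    have n1: "1 \<le> real n" by (simp add: n_def)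
    have "2 / C < real n" unfolding n_def using C(1) by linarith
    then have "2 < C * real n" using C(1) by (simp add: field_simps)
    also have "C * real n \<le> C * real n ^ N"
      using C(1) assms(2) n1 by (intro mult_left_mono self_le_power) auto
    also have "\<dots> \<le> real (growth G S n)" by (rule C) (simp add: n_def)
    also have "\<dots> \<le> 1" using g[of n] by simp
    finally show False by simp
  qed
  have "C / 2 * real n ^ N \<le> real (card (words (2 * n)))" if n: "n \<ge> 1" for n
  proof -
    \<comment> \<open>The radius \<open>2 * n - 1\<close> is at least \<open>n\<close>, and its
      successor is the even word length wanted.\<close>
    have "C * real n ^ N \<le> C * real (2 * n - 1) ^ N"
      using C(1) n by (intro mult_left_mono power_mono) auto
    also have "\<dots> \<le> real (growth G S (2 * n - 1))" using n by (intro C) auto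
    also have "\<dots> \<le> 2 * real (card (words (Suc (2 * n - 1))))"
      using growth_le_card_words[OF S, of "2 * n - 1"] by linarith
    also have "Suc (2 * n - 1) = 2 * n" using n by simp
    finally show ?thesis by simp
  qed
  then show "\<exists>c>0. \<forall>n\<ge>1. c * real n ^ N \<le> real (card (words (2 * n)))"
    using C(1) by (intro exI[of _ "C / 2"]) auto
qed

section \<open>Finitely supported functions and the Nash inequality\<close>

definition fin_supp :: "('a \<Rightarrow> real) \<Rightarrow> bool" where
  "fin_supp f \<longleftrightarrow> finite {x \<in> carrier G. f x \<noteq> 0}"

lemma fin_supp_summable: "fin_supp f \<Longrightarrow> f summable_on carrier G"
  unfolding fin_supp_def by (rule finite_nonzero_values_imp_summable_on)

lemma fin_supp_subset:
  "fin_supp f \<Longrightarrow> (\<And>x. x \<in> carrier G \<Longrightarrow> f x = 0 \<Longrightarrow> h x = 0) \<Longrightarrow> fin_supp h"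
  unfolding fin_supp_def by (erule finite_subset[rotated]) auto

lemma fin_supp_subset2:
  "fin_supp f \<Longrightarrow> fin_supp g \<Longrightarrow> (\<And>x. x \<in> carrier G \<Longrightarrow> f x = 0 \<Longrightarrow> g x = 0 \<Longrightarrow> h x = 0) \<Longrightarrow> fin_supp h"
  unfolding fin_supp_def
  by (rule finite_subset[of _ "{x \<in> carrier G. f x \<noteq> 0} \<union> {x \<in> carrier G. g x \<noteq> 0}"]) auto

lemma fin_supp_translate:
  assumes "fin_supp f" "w \<in> carrier G"
  shows "fin_supp (\<lambda>x. f (x \<otimes> w))"
proof -
  have "{x \<in> carrier G. f (x \<otimes> w) \<noteq> 0} \<subseteq> (\<lambda>x. x \<otimes> inv w) ` {x \<in> carrier G. f x \<noteq> 0}"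
  proof
    fix x assume x: "x \<in> {x \<in> carrier G. f (x \<otimes> w) \<noteq> 0}"
    then have "x = (x \<otimes> w) \<otimes> inv w" using assms by (simp add: m_assoc)
    with x assms show "x \<in> (\<lambda>x. x \<otimes> inv w) ` {x \<in> carrier G. f x \<noteq> 0}" by blast
  qed
  then show ?thesis using assms finite_surj unfolding fin_supp_def by blast
qed

lemma fin_supp_sum: "(\<And>i. i \<in> I \<Longrightarrow> fin_supp (f i)) \<Longrightarrow> fin_supp (\<lambda>x. \<Sum>i\<in>I. f i x)"
proof (induction I rule: infinite_finite_induct)
  case (insert i I)
  then show ?case
    by (auto intro: fin_supp_subset2[of "f i" "\<lambda>x. \<Sum>i\<in>I. f i x"])
qed (auto simp: fin_supp_def)

lemma fin_supp_walk: "fin_supp f \<Longrightarrow> fin_supp (walk f)"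
  by (rule fin_supp_subset[OF fin_supp_sum[of S "\<lambda>s x. f (x \<otimes> s)"]])
    (auto simp: walk_def fin_supp_translate)

lemma infsum_translate:
  assumes "w \<in> carrier G"
  shows "(\<Sum>\<^sub>\<infinity>x\<in>carrier G. f (x \<otimes> w)) = (\<Sum>\<^sub>\<infinity>x\<in>carrier G. f x)"
  using infsum_reindex_bij_betw[OF bij_mult_right[OF assms], of f] by simp

text \<open>Right translations permute the carrier, so averaging preserves the total mass.\<close>

lemma walk_has_sum:
  assumes "(f has_sum a) (carrier G)" "S \<noteq> {}"
  shows "(walk f has_sum a) (carrier G)"
proof -
  have "((\<lambda>x. \<Sum>s\<in>S. f (x \<otimes> s)) has_sum (\<Sum>s\<in>S. a)) (carrier G)"
  proof (rule has_sum_finite_sum)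
    fix s assume "s \<in> S"
    then show "((\<lambda>x. f (x \<otimes> s)) has_sum a) (carrier G)"
      using assms(1) has_sum_reindex_bij_betw[OF bij_mult_right[of s], of f] by simp
  qed
  from has_sum_cmult_right[OF this, of "1 / real (card S)"]
  show ?thesis
    using assms(2) finite_S by (simp add: walk_def[abs_def])
qed

lemma walk_pow_has_sum_total:
  "(f has_sum a) (carrier G) \<Longrightarrow> S \<noteq> {} \<Longrightarrow> ((walk ^^ n) f has_sum a) (carrier G)"
  by (induction n) (auto intro: walk_has_sum)

definition sq_norm :: "('a \<Rightarrow> real) \<Rightarrow> real" where
  "sq_norm f = (\<Sum>\<^sub>\<infinity>x\<in>carrier G. (f x)\<^sup>2)"

lemma sq_norm_nonneg: "sq_norm f \<ge> 0"
  unfolding sq_norm_def by (rule infsum_nonneg) simp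

lemma sq_norm_translate: "w \<in> carrier G \<Longrightarrow> sq_norm (\<lambda>x. f (x \<otimes> w)) = sq_norm f"
  unfolding sq_norm_def by (rule infsum_translate)

lemma fin_supp_diff_translate:
  assumes "fin_supp f" "v \<in> carrier G" "w \<in> carrier G"
  shows "fin_supp (\<lambda>x. f (x \<otimes> v) - f (x \<otimes> w))"
  by (rule fin_supp_subset2[OF fin_supp_translate[OF assms(1,2)] fin_supp_translate[OF assms(1,3)]]) simp

lemma fin_supp_square: "fin_supp f \<Longrightarrow> fin_supp (\<lambda>x. (f x)\<^sup>2)"
  by (erule fin_supp_subset) simp

text \<open>The variance formula for the values \<open>f (x \<otimes> s)\<close>, summed over
  \<open>x\<close>; translation invariance turns every sum of squares into
  \<open>sq_norm f\<close>.\<close>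

lemma energy_identity:
  assumes "fin_supp f" "S \<noteq> {}"
  shows "(\<Sum>s\<in>S. \<Sum>t\<in>S. sq_norm (\<lambda>x. f (x \<otimes> s) - f (x \<otimes> t))) =
    2 * real (card S) ^ 2 * (sq_norm f - sq_norm (walk f))"
proof -
  let ?D = "real (card S)"
  have D: "?D > 0" using assms(2) finite_S by (simp add: card_gt_0_iff)
  have sm: "(\<lambda>x. (f (x \<otimes> s) - f (x \<otimes> t))\<^sup>2) summable_on carrier G" if "s \<in> S" "t \<in> S" for s t
    using that assms by (intro fin_supp_summable fin_supp_square fin_supp_diff_translate) auto
  have sm1: "(\<lambda>x. (f (x \<otimes> s))\<^sup>2) summable_on carrier G" if "s \<in> S" for s
    using that assms by (intro fin_supp_summable fin_supp_square fin_supp_translate) auto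
  have sm2: "(\<lambda>x. (walk f x)\<^sup>2) summable_on carrier G"
    using assms by (intro fin_supp_summable fin_supp_square fin_supp_walk)
  have "(\<Sum>s\<in>S. \<Sum>t\<in>S. sq_norm (\<lambda>x. f (x \<otimes> s) - f (x \<otimes> t))) =
      (\<Sum>\<^sub>\<infinity>x\<in>carrier G. \<Sum>s\<in>S. \<Sum>t\<in>S. (f (x \<otimes> s) - f (x \<otimes> t))\<^sup>2)"
    unfolding sq_norm_def using sm
    by (intro infsumI[symmetric] has_sum_finite_sum has_sum_infsum)
  also have "\<dots> = (\<Sum>\<^sub>\<infinity>x\<in>carrier G. 2 * ?D * (\<Sum>s\<in>S. (f (x \<otimes> s))\<^sup>2) - 2 * ?D\<^sup>2 * (walk f x)\<^sup>2)"
    using D by (simp add: sum_sum_diff_square walk_def power_divide)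
  also have "\<dots> = 2 * ?D * (\<Sum>s\<in>S. sq_norm f) - 2 * ?D\<^sup>2 * sq_norm (walk f)"
  proof (rule infsumI, intro has_sum_diff has_sum_cmult_right has_sum_finite_sum)
    fix s assume s: "s \<in> S"
    have "sq_norm f = sq_norm (\<lambda>x. f (x \<otimes> s))" using s by (simp add: sq_norm_translate)
    then show "((\<lambda>x. (f (x \<otimes> s))\<^sup>2) has_sum sq_norm f) (carrier G)"
      using sm1[OF s] by (simp add: sq_norm_def has_sum_infsum)
  next
    show "((\<lambda>x. (walk f x)\<^sup>2) has_sum sq_norm (walk f)) (carrier G)"
      using sm2 by (simp add: sq_norm_def has_sum_infsum)
  qed
  finally show ?thesis by (simp add: algebra_simps power2_eq_square)
qed

text \<open>One term of a sum of nonnegative terms.\<close>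

lemma sq_norm_diff_le_energy:
  assumes "fin_supp f" "s \<in> S" "t \<in> S"
  shows "sq_norm (\<lambda>x. f (x \<otimes> s) - f (x \<otimes> t)) \<le> 2 * real (card S) ^ 2 * (sq_norm f - sq_norm (walk f))"
proof -
  have "sq_norm (\<lambda>x. f (x \<otimes> s) - f (x \<otimes> t)) \<le> (\<Sum>t\<in>S. sq_norm (\<lambda>x. f (x \<otimes> s) - f (x \<otimes> t)))"
    using assms(3) by (intro member_le_sum sq_norm_nonneg finite_S)
  also have "\<dots> \<le> (\<Sum>s\<in>S. \<Sum>t\<in>S. sq_norm (\<lambda>x. f (x \<otimes> s) - f (x \<otimes> t)))"
    using assms(2) by (intro member_le_sum[of s S "\<lambda>s. \<Sum>t\<in>S. sq_norm (\<lambda>x. f (x \<otimes> s) - f (x \<otimes> t))"] sum_nonneg sq_norm_nonneg finite_S)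
  also have "\<dots> = 2 * real (card S) ^ 2 * (sq_norm f - sq_norm (walk f))"
    using assms by (intro energy_identity) auto
  finally show ?thesis .
qed

text \<open>Letters are removed in pairs, \<open>w = v s t\<close>. The difference between the
  translates by \<open>v\<close> and by \<open>w\<close> is itself a translate of the difference
  belonging to the generators \<open>inv s\<close> and \<open>t\<close>, hence controlled by the
  energy. The weighted square inequality makes the constants grow like \<open>n ^ 2\<close>.\<close>

lemma sq_norm_diff_words_le:
  assumes f: "fin_supp f" and w: "w \<in> words (2 * n)"
  shows "sq_norm (\<lambda>x. f x - f (x \<otimes> w)) \<le>
    real n ^ 2 * (2 * real (card S) ^ 2 * (sq_norm f - sq_norm (walk f)))"
  using w
proof (induction n arbitrary: w)
  case 0
  then have "sq_norm (\<lambda>x. f x - f (x \<otimes> w)) = 0"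
    unfolding sq_norm_def by (intro infsum_0) simp
  then show ?case by simp
next
  case (Suc n)
  define K where "K = 2 * real (card S) ^ 2 * (sq_norm f - sq_norm (walk f))"
  from Suc.prems obtain v s t where v: "v \<in> words (2 * n)" and st: "s \<in> S" "t \<in> S"
    and w: "w = v \<otimes> s \<otimes> t"
    by auto
  have vc: "v \<in> carrier G" using v words_carrier by auto
  have K: "K \<ge> 0"
    using order_trans[OF sq_norm_nonneg sq_norm_diff_le_energy[OF f st(1,1)]] by (simp add: K_def)
  define g1 where "g1 x = f x - f (x \<otimes> v)" for x
  define g2 where "g2 x = f (x \<otimes> v) - f (x \<otimes> w)" for x
  have fs1: "fin_supp g1"
    using vc unfolding g1_def
    by (intro fin_supp_subset[OF fin_supp_diff_translate[OF f one_closed vc]]) auto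
  have fs2: "fin_supp g2"
    unfolding g2_def using vc st by (intro fin_supp_diff_translate f) (auto simp: w)
  have g2: "sq_norm g2 \<le> K"
  proof -
    \<comment> \<open>Translating by the inverse of \<open>v \<otimes> s\<close> turns
      \<open>v\<close> into \<open>inv s\<close> and \<open>w\<close> into \<open>t\<close>.\<close>
    have "sq_norm g2 = sq_norm (\<lambda>x. g2 (x \<otimes> (inv (v \<otimes> s))))"
      using vc st by (simp add: sq_norm_translate)
    also have "\<dots> = sq_norm (\<lambda>x. f (x \<otimes> inv s) - f (x \<otimes> t))"
      unfolding sq_norm_def
    proof (rule infsum_cong)
      fix x assume x: "x \<in> carrier G"
      have "x \<otimes> inv (v \<otimes> s) \<otimes> v = x \<otimes> inv s"
        using x vc st by (simp add: inv_mult_group m_assoc)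
      moreover have "x \<otimes> inv (v \<otimes> s) \<otimes> w = x \<otimes> t"
        using x vc st by (simp add: w m_assoc[symmetric]) (simp add: m_assoc)
      ultimately show "(g2 (x \<otimes> inv (v \<otimes> s)))\<^sup>2 = (f (x \<otimes> inv s) - f (x \<otimes> t))\<^sup>2"
        by (simp add: g2_def)
    qed
    also have "\<dots> \<le> K"
      unfolding K_def using st by (intro sq_norm_diff_le_energy f S_inv)
    finally show ?thesis .
  qed
  have eq: "f x - f (x \<otimes> w) = g1 x + g2 x" for x by (simp add: g1_def g2_def)
  show ?case
  proof (cases "n = 0")
    case True
    with v have "v = \<one>" by simp
    then have "sq_norm (\<lambda>x. f x - f (x \<otimes> w)) = sq_norm g2"
      unfolding sq_norm_def g2_def by (intro infsum_cong) auto
    then show ?thesis using g2 True by (simp add: K_def)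
  next
    case False
    have sm: "(\<lambda>x. (g1 x)\<^sup>2) summable_on carrier G" "(\<lambda>x. (g2 x)\<^sup>2) summable_on carrier G"
      using fs1 fs2 by (auto intro!: fin_supp_summable fin_supp_square)
    have "sq_norm (\<lambda>x. f x - f (x \<otimes> w)) \<le>
        (1 + 1 / real n) * sq_norm g1 + (1 + real n) * sq_norm g2"
      unfolding sq_norm_def eq
    proof (rule has_sum_mono)
      show "((\<lambda>x. (g1 x + g2 x)\<^sup>2) has_sum (\<Sum>\<^sub>\<infinity>x\<in>carrier G. (g1 x + g2 x)\<^sup>2)) (carrier G)"
        by (intro has_sum_infsum fin_supp_summable fin_supp_square fin_supp_subset2[OF fs1 fs2]) simp
      show "((\<lambda>x. (1 + 1 / real n) * (g1 x)\<^sup>2 + (1 + real n) * (g2 x)\<^sup>2) has_sum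
          ((1 + 1 / real n) * (\<Sum>\<^sub>\<infinity>x\<in>carrier G. (g1 x)\<^sup>2) + (1 + real n) * (\<Sum>\<^sub>\<infinity>x\<in>carrier G. (g2 x)\<^sup>2)))
          (carrier G)"
        using sm by (intro has_sum_add has_sum_cmult_right has_sum_infsum)
    qed (use False in \<open>auto intro: square_add_le_weighted\<close>)
    also have "\<dots> \<le> (1 + 1 / real n) * (real n ^ 2 * K) + (1 + real n) * K"
      using Suc.IH[OF v] g2 by (intro add_mono mult_left_mono) (auto simp: g1_def[abs_def] K_def)
    also have "\<dots> = real (Suc n) ^ 2 * K"
      using False by (simp add: field_simps power2_eq_square)
    finally show ?thesis by (simp add: K_def)
  qed
qed

text \<open>For each word \<open>w\<close>, \<open>sq_norm f\<close> is the inner product of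
  \<open>f\<close> with its translate plus half the squared norm of their difference. Averaged over
  \<open>w\<close>, the inner products contribute at most \<open>1 / card W\<close>, since for fixed
  \<open>x\<close> the points \<open>x \<otimes> w\<close> are distinct and \<open>f\<close> has
  total mass 1.\<close>

lemma nash_inequality:
  assumes f: "fin_supp f" "\<And>x. x \<in> carrier G \<Longrightarrow> f x \<ge> 0" and f1: "(f has_sum 1) (carrier G)"
    and ne: "words (2 * n) \<noteq> {}"
  shows "sq_norm f \<le> real (card S) ^ 2 * real n ^ 2 * (sq_norm f - sq_norm (walk f)) +
    1 / real (card (words (2 * n)))"
proof -
  define W where "W = words (2 * n)"
  define K where "K = real (card S) ^ 2 * real n ^ 2 * (sq_norm f - sq_norm (walk f))"
  have W: "finite W" "card W > 0" "W \<subseteq> carrier G"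
    using ne finite_words[of "2 * n"] words_carrier[of "2 * n"]
    by (auto simp: W_def card_gt_0_iff simp del: words.simps)
  have fsm: "fin_supp (\<lambda>x. f x * f (x \<otimes> w))" for w
    using f(1) by (rule fin_supp_subset) simp
  have ind: "sq_norm f \<le> K + (\<Sum>\<^sub>\<infinity>x\<in>carrier G. f x * f (x \<otimes> w))" if w: "w \<in> W" for w
  proof -
    have wc: "w \<in> carrier G" using w W by auto
    have "((\<lambda>x. (f x)\<^sup>2 + (f (x \<otimes> w))\<^sup>2 - 2 * (f x * f (x \<otimes> w))) has_sum
        (sq_norm f + sq_norm (\<lambda>x. f (x \<otimes> w)) - 2 * (\<Sum>\<^sub>\<infinity>x\<in>carrier G. f x * f (x \<otimes> w)))) (carrier G)"
      unfolding sq_norm_def using f(1) wc fsm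
      by (intro has_sum_diff has_sum_add has_sum_cmult_right has_sum_infsum fin_supp_summable
          fin_supp_square fin_supp_translate)
    also have "(\<lambda>x. (f x)\<^sup>2 + (f (x \<otimes> w))\<^sup>2 - 2 * (f x * f (x \<otimes> w))) = (\<lambda>x. (f x - f (x \<otimes> w))\<^sup>2)"
      by (simp add: power2_diff mult.assoc)
    finally have "sq_norm (\<lambda>x. f x - f (x \<otimes> w)) =
        2 * sq_norm f - 2 * (\<Sum>\<^sub>\<infinity>x\<in>carrier G. f x * f (x \<otimes> w))"
      using wc sq_norm_translate[of w f] by (simp add: sq_norm_def infsumI)
    moreover have "sq_norm (\<lambda>x. f x - f (x \<otimes> w)) \<le> 2 * K"
      using sq_norm_diff_words_le[OF f(1), of w n] w by (simp add: W_def K_def mult_ac)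
    ultimately show ?thesis by simp
  qed
  have "real (card W) * sq_norm f = (\<Sum>w\<in>W. sq_norm f)" by simp
  also have "\<dots> \<le> (\<Sum>w\<in>W. K + (\<Sum>\<^sub>\<infinity>x\<in>carrier G. f x * f (x \<otimes> w)))"
    by (rule sum_mono) (rule ind)
  also have "\<dots> = real (card W) * K + (\<Sum>\<^sub>\<infinity>x\<in>carrier G. \<Sum>w\<in>W. f x * f (x \<otimes> w))"
    by (subst infsum_finite_sum) (auto simp: sum.distrib intro: fin_supp_summable fsm)
  also have "(\<Sum>\<^sub>\<infinity>x\<in>carrier G. \<Sum>w\<in>W. f x * f (x \<otimes> w)) \<le> 1"
  proof (rule has_sum_mono[OF has_sum_infsum f1])
    show "(\<lambda>x. \<Sum>w\<in>W. f x * f (x \<otimes> w)) summable_on carrier G"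
      by (intro fin_supp_summable fin_supp_sum fsm)
    fix x assume x: "x \<in> carrier G"
    have "(\<Sum>w\<in>W. f (x \<otimes> w)) = (\<Sum>y\<in>(\<lambda>w. x \<otimes> w) ` W. f y)"
      using x W by (subst sum.reindex) (auto simp: inj_on_def subset_iff)
    also have "\<dots> \<le> 1"
      using W x f(2) by (intro finite_sum_le_has_sum[OF f1]) auto
    finally have "f x * (\<Sum>w\<in>W. f (x \<otimes> w)) \<le> f x * 1"
      using f(2)[OF x] by (rule mult_left_mono)
    then show "(\<Sum>w\<in>W. f x * f (x \<otimes> w)) \<le> f x"
      by (simp add: sum_distrib_left)
  qed
  finally have "real (card W) * sq_norm f \<le> real (card W) * K + 1" by simp
  then have "sq_norm f \<le> K + 1 / real (card W)"
    using W(2) by (simp add: field_simps)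
  then show ?thesis by (simp add: K_def W_def)
qed

section \<open>Pointwise decay of the transition probabilities\<close>

lemma fin_supp_step: "fin_supp (\<lambda>x. step n x y)"
proof (induction n)
  case 0
  then show ?case unfolding fin_supp_def step_def
    by (auto intro!: finite_subset[of _ "{y}"] simp: indicator_def)
next
  case (Suc n)
  then show ?case using fin_supp_walk[of "\<lambda>x. step n x y"] by (simp add: step_def)
qed

lemma step_has_sum:
  assumes "S \<noteq> {}" "y \<in> carrier G"
  shows "((\<lambda>x. step n x y) has_sum 1) (carrier G)"
proof -
  have "((indicator {y} :: 'a \<Rightarrow> real) has_sum 1) (carrier G)"
    by (rule has_sum_finite_neutralI[of "{y}"]) (use assms(2) in auto)
  then show ?thesis
    unfolding step_def using assms(1) by (rule walk_pow_has_sum_total)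
qed

lemma sq_norm_step_translate:
  assumes "x \<in> carrier G"
  shows "sq_norm (\<lambda>y. step n x y) = sq_norm (\<lambda>y. step n y \<one>)"
proof -
  have "sq_norm (\<lambda>y. step n x y) = (\<Sum>\<^sub>\<infinity>y\<in>carrier G. (step n (inv x \<otimes> y) \<one>)\<^sup>2)"
    unfolding sq_norm_def using assms
    by (intro infsum_cong) (simp add: step_sym[of x] step_eq_step_one[of _ x])
  also have "\<dots> = sq_norm (\<lambda>y. step n y \<one>)"
    unfolding sq_norm_def
    using infsum_reindex_bij_betw[OF bij_mult_left[of "inv x"], of "\<lambda>y. (step n y \<one>)\<^sup>2"] assms
    by simp
  finally show ?thesis .
qed

text \<open>Chapman-Kolmogorov and \<open>2 * a * b \<le> a ^ 2 + b ^ 2\<close>; by symmetry and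
  translation both resulting norms coincide.\<close>

lemma step_double_le:
  assumes "x \<in> carrier G"
  shows "step (n + n) x \<one> \<le> sq_norm (\<lambda>y. step n y \<one>)"
proof -
  let ?u = "sq_norm (\<lambda>y. step n y \<one>)"
  have "step (n + n) x \<one> = (walk ^^ n) (\<lambda>y. step n y \<one>) x"
    by (simp add: step_def funpow_add)
  then have "((\<lambda>y. step n x y * step n y \<one>) has_sum step (n + n) x \<one>) (carrier G)"
    using walk_pow_has_sum[OF assms, of n "\<lambda>y. step n y \<one>"] by simp
  moreover have "((\<lambda>y. 1 / 2 * ((step n x y)\<^sup>2 + (step n y \<one>)\<^sup>2)) has_sum (1 / 2 * (?u + ?u))) (carrier G)"
  proof (intro has_sum_cmult_right has_sum_add)
    have "fin_supp (\<lambda>y. step n x y)"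
      by (rule fin_supp_subset[OF fin_supp_step[of n x]]) (simp add: step_sym[OF assms])
    then have "((\<lambda>y. (step n x y)\<^sup>2) has_sum sq_norm (\<lambda>y. step n x y)) (carrier G)"
      unfolding sq_norm_def by (intro has_sum_infsum fin_supp_summable fin_supp_square)
    then show "((\<lambda>y. (step n x y)\<^sup>2) has_sum ?u) (carrier G)"
      by (simp add: sq_norm_step_translate[OF assms])
    show "((\<lambda>y. (step n y \<one>)\<^sup>2) has_sum ?u) (carrier G)"
      unfolding sq_norm_def by (intro has_sum_infsum fin_supp_summable fin_supp_square fin_supp_step)
  qed
  ultimately have "step (n + n) x \<one> \<le> 1 / 2 * (?u + ?u)"
  proof (rule has_sum_mono)
    fix y
    show "step n x y * step n y \<one> \<le> 1 / 2 * ((step n x y)\<^sup>2 + (step n y \<one>)\<^sup>2)"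
      using sum_squares_bound[of "step n x y" "step n y \<one>"] by simp
  qed
  then show ?thesis by simp
qed

text \<open>An odd time is one averaging after an even one, and averaging does not raise an upper
  bound.\<close>

lemma step_le_sq_norm:
  assumes "x \<in> carrier G" "y \<in> carrier G"
  shows "step n x y \<le> sq_norm (\<lambda>z. step (n div 2) z \<one>)"
proof -
  define m where "m = n div 2"
  have "step n x \<one> \<le> sq_norm (\<lambda>z. step m z \<one>)" if x: "x \<in> carrier G" for x
  proof (cases "even n")
    case True
    then have "n = m + m" by (auto simp: m_def)
    then show ?thesis using step_double_le[OF x, of m] by simp
  next
    case False
    then have n: "n = Suc (m + m)" unfolding m_def by presburger
    have "step n x \<one> \<le> (\<Sum>s\<in>S. sq_norm (\<lambda>z. step m z \<one>)) / real (card S)"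
      unfolding n step_Suc using x by (intro divide_right_mono sum_mono step_double_le) auto
    also have "\<dots> \<le> sq_norm (\<lambda>z. step m z \<one>)"
      using sq_norm_nonneg by simp
    finally show ?thesis .
  qed
  from this[of "inv y \<otimes> x"] show ?thesis
    using assms step_eq_step_one[of x y n] by (simp add: m_def)
qed

text \<open>The squared norms of the kernels started at \<open>\<one>\<close> satisfy the Nash
  recursion.\<close>

lemma step_decay:
  assumes "polynomial_growth G S N" "N \<ge> 1"
  obtains C where "C \<ge> 0"
    "\<And>n x y. x \<in> carrier G \<Longrightarrow> y \<in> carrier G \<Longrightarrow> step n x y \<le> C * real (Suc n) powr - (real N / 2)"
proof -
  have S: "S \<noteq> {}" using polynomial_growth_words[OF assms] by auto
  obtain c where c: "c > 0" "\<And>n. n \<ge> 1 \<Longrightarrow> c * real n ^ N \<le> real (card (words (2 * n)))"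
    using polynomial_growth_words[OF assms] by auto
  define u where "u k = sq_norm (\<lambda>y. step k y \<one>)" for k
  have u1: "u k \<le> 1" for k
    unfolding u_def sq_norm_def
  proof (rule has_sum_mono[OF has_sum_infsum step_has_sum[OF S one_closed, of k]])
    show "(\<lambda>y. (step k y \<one>)\<^sup>2) summable_on carrier G"
      by (intro fin_supp_summable fin_supp_square fin_supp_step)
    fix y assume y: "y \<in> carrier G"
    show "(step k y \<one>)\<^sup>2 \<le> step k y \<one>"
      using step_nonneg[OF y, of k \<one>] step_le_1[OF y, of k \<one>]
      by (simp add: power2_eq_square mult_left_le)
  qed
  have rec: "u k \<le> real (card S) ^ 2 * real n ^ 2 * (u k - u (Suc k)) + (1 / c) / real n ^ N"
    if n: "n \<ge> 1" for k n
  proof -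
    have pos: "0 < c * real n ^ N" using c(1) n by simp
    then have ne: "words (2 * n) \<noteq> {}" using c(2)[OF n] by (auto simp del: words.simps)
    have "u k \<le> real (card S) ^ 2 * real n ^ 2 * (u k - u (Suc k)) + 1 / real (card (words (2 * n)))"
      using nash_inequality[OF fin_supp_step[of k \<one>] step_nonneg step_has_sum[OF S one_closed] ne]
      by (simp add: u_def step_def)
    also have "1 / real (card (words (2 * n))) \<le> 1 / (c * real n ^ N)"
      using c(2)[OF n] pos by (intro frac_le) auto
    finally show ?thesis by (simp add: divide_divide_eq_left)
  qed
  have D: "real (card S) ^ 2 \<ge> 1"
    using S finite_S by (simp add: Suc_leI card_gt_0_iff)
  obtain C where C: "C \<ge> 0" "\<And>k. u k \<le> C * real (Suc k) powr - (real N / 2)"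
    by (rule nash_recursion_decay[of u "real (card S) ^ 2" "1 / c" N, OF u1 D _ assms(2) rec])
      (use c(1) in auto)
  have "step n x y \<le> C * 2 powr (real N / 2) * real (Suc n) powr - (real N / 2)"
    if "x \<in> carrier G" "y \<in> carrier G" for n x y
  proof -
    have "step n x y \<le> u (n div 2)"
      unfolding u_def by (rule step_le_sq_norm[OF that])
    also have "\<dots> \<le> C * real (Suc (n div 2)) powr - (real N / 2)" by (rule C)
    \<comment> \<open>Halving the time costs the constant \<open>2 powr (N / 2)\<close>, because
      \<open>Suc (n div 2) \<ge> Suc n / 2\<close>.\<close>
    also have "\<dots> \<le> C * (real (Suc n) / 2) powr - (real N / 2)"
      using C(1) by (intro mult_left_mono powr_mono2') auto
    also have "\<dots> = C * 2 powr (real N / 2) * real (Suc n) powr - (real N / 2)"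
      by (simp add: powr_divide powr_minus field_simps)
    finally show ?thesis .
  qed
  then show ?thesis using C(1) by (intro that[of "C * 2 powr (real N / 2)"]) auto
qed

section \<open>Strong-type bound for the potential operator\<close>

definition unit_ball :: "real \<Rightarrow> ('a \<Rightarrow> real) set" where
  "unit_ball r = {f. (\<forall>x\<in>carrier G. 0 \<le> f x) \<and> (\<lambda>x. f x powr r) summable_on carrier G \<and>
     (\<Sum>\<^sub>\<infinity>x\<in>carrier G. f x powr r) \<le> 1}"

lemma unit_ball_le_1:
  assumes "f \<in> unit_ball r" "r > 0" "x \<in> carrier G"
  shows "f x \<le> 1"
proof -
  have "f x powr r \<le> (\<Sum>\<^sub>\<infinity>x\<in>carrier G. f x powr r)"
    using assms finite_sum_le_infsum[of "\<lambda>x. f x powr r" "carrier G" "{x}"] by (simp add: unit_ball_def)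
  then have "f x powr r \<le> 1" using assms by (simp add: unit_ball_def)
  then show ?thesis
    using assms(2) gr_one_powr[of "f x" r] by (meson not_less)
qed

text \<open>Cut \<open>f\<close> at height \<open>h = m powr -(N / (2 * r))\<close>. The part below
  contributes at most \<open>h\<close>. Above, \<open>f \<le> h powr (1 - r) * f powr r\<close>, and
  the kernel bound applied to \<open>f powr r\<close> gives a multiple of \<open>h\<close>
  again.\<close>

lemma walk_pow_decay:
  assumes "polynomial_growth G S N" "N \<ge> 1" "r \<ge> 1"
  obtains C where "C \<ge> 0"
    "\<And>n x f. x \<in> carrier G \<Longrightarrow> f \<in> unit_ball r \<Longrightarrow>
      (walk ^^ n) f x \<le> C * real (Suc n) powr - (real N / (2 * r))"
proof -
  obtain C where C: "C \<ge> 0"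
    "\<And>n x y. x \<in> carrier G \<Longrightarrow> y \<in> carrier G \<Longrightarrow> step n x y \<le> C * real (Suc n) powr - (real N / 2)"
    using step_decay[OF assms(1,2)] by blast
  have "(walk ^^ n) f x \<le> (1 + C) * real (Suc n) powr - (real N / (2 * r))"
    if x: "x \<in> carrier G" and f: "f \<in> unit_ball r" for n x f
  proof -
    define m where "m = real (Suc n)"
    define h where "h = m powr - (real N / (2 * r))"
    have h: "h > 0" by (simp add: h_def m_def)
    have f0: "\<And>y. y \<in> carrier G \<Longrightarrow> f y \<ge> 0"
      and sf: "((\<lambda>x. f x powr r) has_sum (\<Sum>\<^sub>\<infinity>x\<in>carrier G. f x powr r)) (carrier G)"
      and f1: "(\<Sum>\<^sub>\<infinity>x\<in>carrier G. f x powr r) \<le> 1"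
      using f by (auto simp: unit_ball_def)
    have "(walk ^^ n) (\<lambda>y. f y powr r) x \<le>
        C * m powr - (real N / 2) * (\<Sum>\<^sub>\<infinity>x\<in>carrier G. f x powr r)"
      using C(2)[OF x, of _ n]
      by (intro has_sum_mono[OF walk_pow_has_sum[OF x] has_sum_cmult_right[OF sf]] mult_right_mono)
        (auto simp: m_def)
    also have "\<dots> \<le> C * m powr - (real N / 2)"
      using C(1) f1 by (intro mult_left_le) auto
    finally have le: "(walk ^^ n) (\<lambda>y. f y powr r) x \<le> C * m powr - (real N / 2)" .
    have "(walk ^^ n) f x \<le> (walk ^^ n) (\<lambda>y. h + h powr (1 - r) * f y powr r) x"
      using x h assms(3) by (intro walk_pow_mono le_truncation f0)
    also have "\<dots> = (walk ^^ n) (\<lambda>y. h) x + h powr (1 - r) * (walk ^^ n) (\<lambda>y. f y powr r) x"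
      by (simp add: walk_pow_add walk_pow_cmult)
    also have "\<dots> \<le> h + h powr (1 - r) * (C * m powr - (real N / 2))"
      using h le by (intro add_mono walk_pow_const_le mult_left_mono) auto
    also have "h powr (1 - r) * (C * m powr - (real N / 2)) = C * h"
    proof -
      have "- (real N / (2 * r)) * (1 - r) + - (real N / 2) = - (real N / (2 * r))"
        using assms(3) by (simp add: field_simps)
      then show ?thesis
        by (simp add: h_def powr_powr flip: powr_add)
    qed
    finally show ?thesis by (simp add: h_def m_def algebra_simps)
  qed
  then show ?thesis using C(1) by (intro that[of "1 + C"]) auto
qed

text \<open>The series for the power \<open>-\<beta>\<close> of \<open>1 - walk\<close>. With
  \<open>\<beta> = \<alpha> / 2\<close> it represents convolution with the Green's function up to
  the factor \<open>card S powr -\<beta>\<close>.\<close>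

definition potential :: "real \<Rightarrow> ('a \<Rightarrow> real) \<Rightarrow> 'a \<Rightarrow> real" where
  "potential \<beta> f x = (\<Sum>n. rising_binomial \<beta> n * (walk ^^ n) f x)"

text \<open>Truncating the potential at time \<open>T\<close> and the function at height \<open>T powr -\<gamma>\<close>
  balances the error of both truncations.\<close>
lemma potential_split:
  assumes "polynomial_growth G S N" "N \<ge> 1" "r \<ge> 1" "\<beta> > 0"
  defines "\<gamma> \<equiv> real N / (2 * r)"
  assumes "\<beta> < \<gamma>"
  obtains B where "B > 0"
    "\<And>f x. f \<in> unit_ball r \<Longrightarrow> x \<in> carrier G \<Longrightarrow> summable (\<lambda>n. rising_binomial \<beta> n * (walk ^^ n) f x)"
    "\<And>f x T. f \<in> unit_ball r \<Longrightarrow> x \<in> carrier G \<Longrightarrow> T \<ge> 1 \<Longrightarrow>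
      potential \<beta> f x \<le> B * real T powr (\<beta> - \<gamma>) +
        (\<Sum>n<T. rising_binomial \<beta> n * (walk ^^ n) (\<lambda>y. if f y > real T powr - \<gamma> then f y else 0) x)"
proof -
  obtain C where C: "C \<ge> 0" "\<And>n x f. x \<in> carrier G \<Longrightarrow> f \<in> unit_ball r \<Longrightarrow>
      (walk ^^ n) f x \<le> C * real (Suc n) powr - \<gamma>"
    using walk_pow_decay[OF assms(1-3)] unfolding \<gamma>_def by blast
  obtain M where M: "M \<ge> 0" "\<And>n. n \<ge> 1 \<Longrightarrow> pochhammer \<beta> n / fact n \<le> M * real n powr (\<beta> - 1)"
    using pochhammer_fact_bound[OF assms(4)] by blast
  obtain P where P: "P > 0" "\<And>T. T \<ge> 1 \<Longrightarrow> (\<Sum>n<T. rising_binomial \<beta> n) \<le> P * real T powr \<beta>"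
    using rising_binomial_partial_sum_bound[OF assms(4)] by blast
  obtain Q where Q: "Q \<ge> 0"
    "\<And>m. m \<ge> 1 \<Longrightarrow> summable (\<lambda>n. real (n + m) powr (- 1 - (\<gamma> - \<beta>)))"
    "\<And>m. m \<ge> 1 \<Longrightarrow> (\<Sum>n. real (n + m) powr (- 1 - (\<gamma> - \<beta>))) \<le> Q * real m powr - (\<gamma> - \<beta>)"
    using powr_tail_bound[of "\<gamma> - \<beta>"] assms(6) by auto
  have \<gamma>: "\<gamma> > 0" using assms(4,6) by simp
  have term_nonneg: "0 \<le> rising_binomial \<beta> n * (walk ^^ n) f x"
    if "\<And>y. y \<in> carrier G \<Longrightarrow> 0 \<le> f y" "x \<in> carrier G" for f x n
    using that by (intro mult_nonneg_nonneg rising_binomial_nonneg walk_pow_nonneg assms)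
  \<comment> \<open>The coefficient has exponent \<open>\<beta> - 1\<close> and the averaged
    function \<open>-\<gamma>\<close>; as \<open>\<beta> < \<gamma>\<close>, the total is below
    -1.\<close>
  have term_le: "rising_binomial \<beta> n * (walk ^^ n) f x \<le> M * C * real n powr (- 1 - (\<gamma> - \<beta>))"
    if f: "f \<in> unit_ball r" and x: "x \<in> carrier G" and n: "n \<ge> 1" for f x n
  proof -
    have "rising_binomial \<beta> n * (walk ^^ n) f x \<le> (M * real n powr (\<beta> - 1)) * (C * real n powr - \<gamma>)"
    proof (rule mult_mono)
      have "real (Suc n) powr - \<gamma> \<le> real n powr - \<gamma>"
        using \<gamma> n by (intro powr_mono2') auto
      then show "(walk ^^ n) f x \<le> C * real n powr - \<gamma>"
        using C(2)[OF x f, of n] C(1) mult_left_mono order_trans by blast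
      show "0 \<le> (walk ^^ n) f x"
        using f x by (intro walk_pow_nonneg) (auto simp: unit_ball_def)
    qed (use M n in \<open>auto simp: rising_binomial_def\<close>)
    also have "\<dots> = M * C * (real n powr (\<beta> - 1) * real n powr - \<gamma>)" by simp
    also have "real n powr (\<beta> - 1) * real n powr - \<gamma> = real n powr (- 1 - (\<gamma> - \<beta>))"
      by (simp flip: powr_add add: algebra_simps)
    finally show ?thesis .
  qed
  have sm: "summable (\<lambda>n. rising_binomial \<beta> n * (walk ^^ n) f x)"
    if f: "f \<in> unit_ball r" and x: "x \<in> carrier G" for f x
  proof (rule summable_comparison_test'[of "\<lambda>n. M * C * real n powr (- 1 - (\<gamma> - \<beta>))" 1])
    have "summable (\<lambda>n. real n powr (- 1 - (\<gamma> - \<beta>)))"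
      using Q(2)[of 1] summable_iff_shift[of "\<lambda>n. real n powr (- 1 - (\<gamma> - \<beta>))" 1] by simp
    then show "summable (\<lambda>n. M * C * real n powr (- 1 - (\<gamma> - \<beta>)))"
      by (rule summable_mult)
    show "norm (rising_binomial \<beta> n * (walk ^^ n) f x) \<le> M * C * real n powr (- 1 - (\<gamma> - \<beta>))"
      if "n \<ge> 1" for n
      using term_le[OF f x that] term_nonneg[of f x n] f x by (simp add: unit_ball_def)
  qed
  show ?thesis
  proof (rule that[of "M * C * Q + P"])
    show "M * C * Q + P > 0"
      using M C Q P by (intro add_nonneg_pos) auto
    fix f x assume f: "f \<in> unit_ball r" and x: "x \<in> carrier G"
    show "summable (\<lambda>n. rising_binomial \<beta> n * (walk ^^ n) f x)" by (rule sm[OF f x])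
    fix T :: nat assume T: "T \<ge> 1"
    define h where "h = real T powr - \<gamma>"
    have h: "h > 0" using T by (simp add: h_def)
    define f2 where "f2 y = (if f y > h then f y else 0)" for y
    have "potential \<beta> f x = (\<Sum>n. rising_binomial \<beta> (n + T) * (walk ^^ (n + T)) f x) +
        (\<Sum>n<T. rising_binomial \<beta> n * (walk ^^ n) f x)"
      unfolding potential_def by (rule suminf_split_initial_segment[OF sm[OF f x]])
    also have "(\<Sum>n. rising_binomial \<beta> (n + T) * (walk ^^ (n + T)) f x) \<le>
        (\<Sum>n. M * C * real (n + T) powr (- 1 - (\<gamma> - \<beta>)))"
      by (intro suminf_le term_le[OF f x] summable_mult[OF Q(2)[OF T]]
          summable_ignore_initial_segment[OF sm[OF f x]]) (use T in auto)
    also have "\<dots> = M * C * (\<Sum>n. real (n + T) powr (- 1 - (\<gamma> - \<beta>)))"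
      by (rule suminf_mult[OF Q(2)[OF T]])
    also have "\<dots> \<le> M * C * (Q * real T powr - (\<gamma> - \<beta>))"
      using Q(3)[OF T] M(1) C(1) by (intro mult_left_mono) auto
    \<comment> \<open>Pointwise \<open>f \<le> h + f2\<close>. The constant \<open>h\<close> is
      multiplied by the sum of the first \<open>T\<close> coefficients, giving the same order
      \<open>T powr (\<beta> - \<gamma>)\<close> as the tail.\<close>
    also have "(\<Sum>n<T. rising_binomial \<beta> n * (walk ^^ n) f x) \<le>
        (\<Sum>n<T. rising_binomial \<beta> n * (h + (walk ^^ n) f2 x))"
    proof (intro sum_mono mult_left_mono rising_binomial_nonneg assms)
      fix n
      have "(walk ^^ n) f x \<le> (walk ^^ n) (\<lambda>y. h + f2 y) x"
        using f x h by (intro walk_pow_mono) (auto simp: f2_def unit_ball_def)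
      also have "\<dots> \<le> h + (walk ^^ n) f2 x"
        using h by (simp add: walk_pow_add walk_pow_const_le)
      finally show "(walk ^^ n) f x \<le> h + (walk ^^ n) f2 x" .
    qed
    also have "\<dots> = (\<Sum>n<T. rising_binomial \<beta> n) * h + (\<Sum>n<T. rising_binomial \<beta> n * (walk ^^ n) f2 x)"
      by (simp add: distrib_left sum.distrib sum_distrib_right)
    also have "(\<Sum>n<T. rising_binomial \<beta> n) * h \<le> P * real T powr \<beta> * h"
      using P(2)[OF T] h by (intro mult_right_mono) auto
    also have "P * real T powr \<beta> * h = P * real T powr (\<beta> - \<gamma>)"
      by (simp add: h_def powr_diff powr_minus field_simps)
    finally show "potential \<beta> f x \<le> (M * C * Q + P) * real T powr (\<beta> - \<gamma>) +
        (\<Sum>n<T. rising_binomial \<beta> n * (walk ^^ n) (\<lambda>y. if f y > real T powr - \<gamma> then f y else 0) x)"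
      unfolding f2_def h_def by (simp add: algebra_simps)
  qed
qed

text \<open>A positive value \<open>v\<close> of the potential is assigned the first dyadic time
  whose level lies below \<open>v\<close>. There the part \<open>E\<close> of the splitting is at
  least half the level, so \<open>v powr t\<close> is at most a multiple of \<open>E\<close>, which
  is controlled in \<open>\<ell>\<^sup>1\<close>. The bound is uniform in the finite set
  \<open>F\<close>, so it later yields summability too.\<close>

lemma potential_strong_bound:
  assumes "polynomial_growth G S N" "N \<ge> 1" "r > 1" "\<beta> > 0"
  defines "\<gamma> \<equiv> real N / (2 * r)"
  assumes "\<beta> < \<gamma>"
  defines "t \<equiv> real N / (2 * (\<gamma> - \<beta>))"
  obtains K where "K \<ge> 0"
    "\<And>f F. f \<in> unit_ball r \<Longrightarrow> finite F \<Longrightarrow> F \<subseteq> carrier G \<Longrightarrow>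
      (\<Sum>x\<in>F. potential \<beta> f x powr t) \<le> K"
proof -
  have S: "S \<noteq> {}" using polynomial_growth_words[OF assms(1,2)] by auto
  define \<eta> where "\<eta> = \<gamma> - \<beta>"
  have pos: "\<eta> > 0" "\<gamma> > 0" "t > 0"
    using assms by (auto simp: \<eta>_def)
  obtain B where B: "B > 0"
    "\<And>f x. f \<in> unit_ball r \<Longrightarrow> x \<in> carrier G \<Longrightarrow> summable (\<lambda>n. rising_binomial \<beta> n * (walk ^^ n) f x)"
    "\<And>f x T. f \<in> unit_ball r \<Longrightarrow> x \<in> carrier G \<Longrightarrow> T \<ge> 1 \<Longrightarrow>
      potential \<beta> f x \<le> B * real T powr (\<beta> - \<gamma>) +
        (\<Sum>n<T. rising_binomial \<beta> n * (walk ^^ n) (\<lambda>y. if f y > real T powr - \<gamma> then f y else 0) x)"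
    using potential_split[OF assms(1,2) less_imp_le[OF assms(3)] assms(4)] assms(6)
    unfolding \<gamma>_def by blast
  obtain P where P: "P > 0" "\<And>T. T \<ge> 1 \<Longrightarrow> (\<Sum>n<T. rising_binomial \<beta> n) \<le> P * real T powr \<beta>"
    using rising_binomial_partial_sum_bound[OF assms(4)] by blast
  define T where "T j = (2::nat) ^ j" for j
  have T: "T j \<ge> 1" for j by (simp add: T_def)
  have Tpos: "real (T j) > 0" for j using T[of j] by linarith
  have T_powr: "real (T j) powr a = (2 powr a) ^ j" for j a
    by (simp add: T_def powr_power powr_realpow[symmetric] powr_powr mult.commute)
  have T_Suc: "real (T (Suc j)) powr a = 2 powr a * real (T j) powr a" for j a
    by (simp add: T_powr)
  \<comment> \<open>Twice the error of the splitting at time \<open>T j\<close>, so that this error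
    uses up only half of the level.\<close>
  define lev where "lev j = 2 * B * real (T j) powr - \<eta>" for j
  have lev_pos: "lev j > 0" for j using B(1) Tpos[of j] by (simp add: lev_def)
  have lev_lim: "lev \<longlonglongrightarrow> 0"
  proof -
    have "(2::real) powr - \<eta> < 1" using pos by (simp add: powr_less_one)
    then have "(\<lambda>j. 2 * B * (2 powr - \<eta>) ^ j) \<longlonglongrightarrow> 0"
      by (intro tendsto_mult_right_zero LIMSEQ_realpow_zero) auto
    then show ?thesis by (simp add: lev_def[abs_def] T_powr)
  qed
  \<comment> \<open>The ratio of the geometric series over the scales; it is below 1 because
    \<open>r > 1\<close>.\<close>
  define q where "q = (2::real) powr - (\<gamma> * (r - 1))"
  have q: "0 < q" "q < 1" using pos assms(3) by (auto simp: q_def powr_less_one)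
  define K1 where "K1 = (2 * B) powr t * 2 powr (real N / 2) / B"
  have K1: "K1 > 0" using B(1) by (simp add: K1_def)
  \<comment> \<open>The weight for which \<open>v \<le> lev i\<close> and
    \<open>lev (Suc i) \<le> 2 * E (Suc i) x\<close> give
    \<open>v powr t \<le> W i * E (Suc i) x\<close>.\<close>
  define W where "W i = lev i powr t * 2 / lev (Suc i)" for i
  have W_pos: "W i > 0" for i using lev_pos[of i] lev_pos[of "Suc i"] by (simp add: W_def)
  \<comment> \<open>Exponent count: \<open>-(N / 2)\<close> from \<open>lev i powr t\<close>,
    \<open>\<eta>\<close> from the inverse level, and \<open>\<beta>\<close>. The choice of
    \<open>t\<close> and \<open>\<gamma> * r = N / 2\<close> make the sum
    \<open>-\<gamma> * (r - 1)\<close>.\<close>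
  have W: "W i * real (T (Suc i)) powr \<beta> = K1 * q ^ Suc i" for i
  proof -
    let ?T = "real (T (Suc i))"
    have "lev i powr t = (2 * B) powr t * real (T i) powr (- \<eta> * t)"
      using B(1) by (simp add: lev_def powr_mult powr_powr)
    also have "- \<eta> * t = - (real N / 2)"
      using pos by (simp add: t_def \<eta>_def[symmetric])
    also have "real (T i) powr - (real N / 2) = 2 powr (real N / 2) * ?T powr - (real N / 2)"
      by (simp add: T_Suc powr_minus field_simps)
    finally have "W i * ?T powr \<beta> =
        K1 * (?T powr - (real N / 2) * ?T powr \<eta> * ?T powr \<beta>)"
      using B(1) Tpos[of "Suc i"] by (simp add: W_def lev_def K1_def powr_minus field_simps)
    also have "?T powr - (real N / 2) * ?T powr \<eta> * ?T powr \<beta> = ?T powr - (\<gamma> * (r - 1))"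
    proof -
      have "\<gamma> * r = real N / 2" using assms(3) by (simp add: \<gamma>_def)
      then have "- (real N / 2) + \<eta> + \<beta> = - (\<gamma> * (r - 1))" by (simp add: \<eta>_def algebra_simps)
      then show ?thesis by (simp flip: powr_add)
    qed
    also have "\<dots> = q ^ Suc i" unfolding T_powr q_def ..
    finally show ?thesis .
  qed
  define K where "K = K1 * P / (1 - q)"
  show ?thesis
  proof (rule that[of K])
    show "K \<ge> 0" using K1 P(1) q by (simp add: K_def)
    fix f F assume f: "f \<in> unit_ball r" and F: "finite F" "F \<subseteq> carrier G"
    have f0: "\<And>y. y \<in> carrier G \<Longrightarrow> f y \<ge> 0"
      and sf: "(\<lambda>x. f x powr r) summable_on carrier G"
      and f1: "(\<Sum>\<^sub>\<infinity>x\<in>carrier G. f x powr r) \<le> 1"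
      using f by (auto simp: unit_ball_def)
    define g where "g j y = (if f y > real (T j) powr - \<gamma> then f y else 0)" for j y
    have g0: "g j y \<ge> 0" if "y \<in> carrier G" for j y using f0[OF that] by (simp add: g_def)
    \<comment> \<open>Above a positive height \<open>f\<close> is dominated by a multiple of
      \<open>f powr r\<close>, so the upper truncation is summable.\<close>
    have sg: "g j summable_on carrier G" for j
    proof (rule summable_on_comparison_test)
      show "(\<lambda>x. (real (T j) powr - \<gamma>) powr (1 - r) * f x powr r) summable_on carrier G"
        by (intro summable_on_cmult_right sf)
      fix y assume y: "y \<in> carrier G"
      show "g j y \<le> (real (T j) powr - \<gamma>) powr (1 - r) * f y powr r"
        unfolding g_def using f0[OF y] Tpos[of j] assms(3) by (intro le_truncation(2)) auto
    qed (rule g0)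
    define E where "E j x = (\<Sum>n<T j. rising_binomial \<beta> n * (walk ^^ n) (g j) x)" for j x
    have E0: "E j x \<ge> 0" if "x \<in> carrier G" for j x
      unfolding E_def using that
      by (intro sum_nonneg mult_nonneg_nonneg rising_binomial_nonneg walk_pow_nonneg g0 assms)
    have split: "potential \<beta> f x \<le> lev j / 2 + E j x" if "x \<in> carrier G" for x j
    proof -
      have "\<beta> - \<gamma> = - \<eta>" by (simp add: \<eta>_def)
      then show ?thesis
        using B(3)[OF f that T, of j] unfolding E_def g_def lev_def by simp
    qed
    have E_sum: "(\<Sum>x\<in>F. E j x) \<le> P * real (T j) powr \<beta> * (\<Sum>\<^sub>\<infinity>y\<in>carrier G. g j y)" for j
    proof -
      have "(\<Sum>x\<in>F. E j x) = (\<Sum>n<T j. rising_binomial \<beta> n * (\<Sum>x\<in>F. (walk ^^ n) (g j) x))"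
        unfolding E_def by (subst sum.swap) (simp add: sum_distrib_left)
      also have "\<dots> \<le> (\<Sum>n<T j. rising_binomial \<beta> n * (\<Sum>\<^sub>\<infinity>y\<in>carrier G. g j y))"
        using F g0
        by (intro sum_mono mult_left_mono rising_binomial_nonneg assms
            finite_sum_le_has_sum[OF walk_pow_has_sum_total[OF has_sum_infsum[OF sg] S]] walk_pow_nonneg) auto
      also have "\<dots> = (\<Sum>n<T j. rising_binomial \<beta> n) * (\<Sum>\<^sub>\<infinity>y\<in>carrier G. g j y)"
        by (simp add: sum_distrib_right)
      also have "\<dots> \<le> P * real (T j) powr \<beta> * (\<Sum>\<^sub>\<infinity>y\<in>carrier G. g j y)"
        using P(2)[OF T] g0 by (intro mult_right_mono infsum_nonneg) auto
      finally show ?thesis .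
    qed
    have "\<exists>i. potential \<beta> f x powr t \<le> W i * E (Suc i) x" if x: "x \<in> F" for x
    proof -
      have xc: "x \<in> carrier G" using x F by auto
      define v where "v = potential \<beta> f x"
      have v0: "v \<ge> 0"
        unfolding v_def potential_def using B(2)[OF f xc] xc f0
        by (intro suminf_nonneg mult_nonneg_nonneg rising_binomial_nonneg walk_pow_nonneg assms) auto
      show ?thesis
      proof (cases "v = 0")
        case True
        then show ?thesis
          using E0[OF xc, of "Suc 0"] W_pos[of 0] by (auto simp: v_def intro!: exI[of _ 0])
      next
        case False
        with v0 have v: "v > 0" by simp
        have "eventually (\<lambda>j. lev j < v) sequentially"
          using lev_lim v by (rule order_tendstoD)
        then obtain j0 where j0: "lev j0 < v" by (auto simp: eventually_sequentially)
        \<comment> \<open>The first level below \<open>v\<close>; minimality makes the preceding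
          level an upper bound of \<open>v\<close>.\<close>
        define j where "j = (LEAST j. lev j < v)"
        have j: "lev j < v" unfolding j_def using j0 by (rule LeastI)
        \<comment> \<open>At scale 0 the height is 1, which \<open>f\<close> never exceeds, so
          \<open>E 0 x\<close> vanishes and \<open>v \<le> lev 0 / 2\<close>.\<close>
        have "j \<noteq> 0"
        proof
          assume "j = 0"
          have "E 0 x = g 0 x" by (simp add: E_def T_def rising_binomial_def)
          also have "g 0 x = 0"
            using unit_ball_le_1[OF f _ xc] assms(3) by (simp add: g_def T_def)
          finally have "v \<le> lev 0 / 2" using split[OF xc, of 0] by (simp add: v_def)
          with j \<open>j = 0\<close> lev_pos[of 0] show False by simp
        qed
        then obtain i where i: "j = Suc i" by (cases j) auto
        have vi: "v \<le> lev i"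
          using not_less_Least[of i "\<lambda>j. lev j < v"] i unfolding j_def by simp
        have "lev (Suc i) \<le> 2 * E (Suc i) x"
          using split[OF xc, of "Suc i"] j i by (simp add: v_def)
        then have "1 \<le> 2 / lev (Suc i) * E (Suc i) x"
          using lev_pos[of "Suc i"] by (simp add: field_simps)
        then have "lev i powr t * 1 \<le> lev i powr t * (2 / lev (Suc i) * E (Suc i) x)"
          by (intro mult_left_mono) auto
        moreover have "v powr t \<le> lev i powr t"
          using vi v pos by (intro powr_mono2) auto
        ultimately show ?thesis by (auto simp: v_def W_def intro!: exI[of _ i])
      qed
    qed
    then obtain i where i: "\<And>x. x \<in> F \<Longrightarrow> potential \<beta> f x powr t \<le> W (i x) * E (Suc (i x)) x"
      by metis
    define J where "J = Suc (Max (i ` F))"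
    have iJ: "i x < J" if "x \<in> F" for x
      unfolding J_def using that F by (simp add: less_Suc_eq_le)
    \<comment> \<open>Summation over scales at a fixed point. At the least scale \<open>k\<close>
      whose height lies below \<open>f y\<close>, \<open>q ^ k\<close> is the power
      \<open>r - 1\<close> of that height, hence at most \<open>f y powr (r - 1)\<close>.\<close>
    have pointwise: "(\<Sum>k<J. q ^ Suc k * g (Suc k) y) \<le> f y powr r / (1 - q)"
      if y: "y \<in> carrier G" for y
    proof -
      define A where "A = {k. k \<in> {1..J} \<and> f y > real (T k) powr - \<gamma>}"
      have "(\<Sum>k<J. q ^ Suc k * g (Suc k) y) = (\<Sum>k\<in>{1..J}. q ^ k * g k y)"
        by (rule sum.reindex_bij_witness[of _ "\<lambda>k. k - 1" Suc]) auto
      also have "\<dots> = (\<Sum>k\<in>A. q ^ k * f y)"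
        unfolding A_def g_def by (subst sum.inter_filter) (auto intro!: sum.cong)
      also have "\<dots> = (\<Sum>k\<in>A. q ^ k) * f y" by (simp add: sum_distrib_right)
      also have "\<dots> \<le> f y powr r / (1 - q)"
      proof (cases "A = {}")
        case False
        have fin: "finite A" by (simp add: A_def)
        have "Min A \<in> A" using Min_in[OF fin False] .
        then have lt: "real (T (Min A)) powr - \<gamma> < f y" by (simp add: A_def)
        then have fy: "f y > 0" by (rule le_less_trans[rotated]) simp
        have "q ^ Min A = (real (T (Min A)) powr - \<gamma>) powr (r - 1)"
          by (simp add: q_def T_powr[symmetric] powr_powr)
        also have "\<dots> \<le> f y powr (r - 1)"
          using lt assms(3) by (intro powr_mono2) auto
        finally have qle: "q ^ Min A \<le> f y powr (r - 1)" .
        have "(\<Sum>k\<in>A. q ^ k) \<le> q ^ Min A / (1 - q)"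
          by (rule geometric_sum_Min_le[OF q fin False])
        also have "\<dots> \<le> f y powr (r - 1) / (1 - q)"
          using qle q by (intro divide_right_mono) auto
        finally have "(\<Sum>k\<in>A. q ^ k) * f y \<le> f y powr (r - 1) / (1 - q) * f y"
          using fy by (intro mult_right_mono) auto
        also have "\<dots> = f y powr r / (1 - q)"
          using fy by (simp add: powr_diff)
        finally show ?thesis .
      qed (use q in auto)
      finally show ?thesis .
    qed
    \<comment> \<open>The scale \<open>i x\<close> depends on \<open>x\<close>; summing over all
      scales below \<open>J\<close> removes the dependence and allows the sums to be
      exchanged.\<close>
    have "(\<Sum>x\<in>F. potential \<beta> f x powr t) \<le> (\<Sum>x\<in>F. \<Sum>k<J. W k * E (Suc k) x)"
    proof (rule sum_mono)
      fix x assume x: "x \<in> F"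
      have "W (i x) * E (Suc (i x)) x \<le> (\<Sum>k<J. W k * E (Suc k) x)"
        using iJ[OF x] x F(2) W_pos E0
        by (intro member_le_sum[of "i x" "{..<J}" "\<lambda>k. W k * E (Suc k) x"] mult_nonneg_nonneg) (auto intro: less_imp_le)
      with i[OF x] show "potential \<beta> f x powr t \<le> (\<Sum>k<J. W k * E (Suc k) x)" by simp
    qed
    also have "\<dots> = (\<Sum>k<J. W k * (\<Sum>x\<in>F. E (Suc k) x))"
      by (subst sum.swap) (simp add: sum_distrib_left)
    also have "\<dots> \<le> (\<Sum>k<J. W k * (P * real (T (Suc k)) powr \<beta> * (\<Sum>\<^sub>\<infinity>y\<in>carrier G. g (Suc k) y)))"
      using W_pos by (intro sum_mono mult_left_mono E_sum) (auto intro: less_imp_le)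
    also have "\<dots> = (\<Sum>k<J. K1 * P * (q ^ Suc k * (\<Sum>\<^sub>\<infinity>y\<in>carrier G. g (Suc k) y)))"
    proof (rule sum.cong[OF refl])
      fix k
      have "W k * (P * real (T (Suc k)) powr \<beta> * (\<Sum>\<^sub>\<infinity>y\<in>carrier G. g (Suc k) y)) =
          (W k * real (T (Suc k)) powr \<beta>) * P * (\<Sum>\<^sub>\<infinity>y\<in>carrier G. g (Suc k) y)"
        by (simp only: mult_ac)
      then show "W k * (P * real (T (Suc k)) powr \<beta> * (\<Sum>\<^sub>\<infinity>y\<in>carrier G. g (Suc k) y)) =
          K1 * P * (q ^ Suc k * (\<Sum>\<^sub>\<infinity>y\<in>carrier G. g (Suc k) y))"
        unfolding W by (simp only: mult_ac)
    qed
    also have "\<dots> = K1 * P * (\<Sum>k<J. \<Sum>\<^sub>\<infinity>y\<in>carrier G. q ^ Suc k * g (Suc k) y)"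
      using sg by (simp add: sum_distrib_left infsum_cmult_right del: power_Suc)
    also have "(\<Sum>k<J. \<Sum>\<^sub>\<infinity>y\<in>carrier G. q ^ Suc k * g (Suc k) y) \<le>
        (\<Sum>\<^sub>\<infinity>y\<in>carrier G. f y powr r / (1 - q))"
    proof (rule has_sum_mono)
      show "((\<lambda>y. \<Sum>k<J. q ^ Suc k * g (Suc k) y) has_sum
          (\<Sum>k<J. \<Sum>\<^sub>\<infinity>y\<in>carrier G. q ^ Suc k * g (Suc k) y)) (carrier G)"
        by (intro has_sum_finite_sum has_sum_infsum summable_on_cmult_right sg)
      show "((\<lambda>y. f y powr r / (1 - q)) has_sum (\<Sum>\<^sub>\<infinity>y\<in>carrier G. f y powr r / (1 - q))) (carrier G)"
        using summable_on_cmult_right[OF sf, of "1 / (1 - q)"] by (intro has_sum_infsum) simp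
    qed (rule pointwise)
    also have "(\<Sum>\<^sub>\<infinity>y\<in>carrier G. f y powr r / (1 - q)) = 1 / (1 - q) * (\<Sum>\<^sub>\<infinity>y\<in>carrier G. f y powr r)"
      using infsum_cmult_right[of "1 / (1 - q)" "\<lambda>y. f y powr r" "carrier G"] sf by simp
    also have "\<dots> \<le> 1 / (1 - q)"
      using f1 q by (intro mult_left_le) auto
    finally show "(\<Sum>x\<in>F. potential \<beta> f x powr t) \<le> K"
      using K1 P(1) by (simp add: K_def)
  qed
qed

section \<open>The Hardy-Littlewood-Sobolev inequality\<close>

lemma indicator_unit_ball: "y \<in> carrier G \<Longrightarrow> indicator {y} \<in> unit_ball 1"
proof -
  assume y: "y \<in> carrier G"
  have "((\<lambda>x. indicator {y} x powr 1 :: real) has_sum 1) (carrier G)"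
    by (rule has_sum_finite_neutralI[of "{y}"]) (use y in auto)
  then show ?thesis
    by (auto simp: unit_ball_def has_sum_iff)
qed

text \<open>The case \<open>r = 1\<close> of the potential, applied to the unit mass at
  \<open>y\<close>. There \<open>\<gamma> = N / 2\<close>.\<close>

lemma summable_rising_binomial_step:
  assumes "polynomial_growth G S N" "N \<ge> 1" "\<beta> > 0" "\<beta> < real N / 2"
    and "x \<in> carrier G" "y \<in> carrier G"
  shows "summable (\<lambda>n. rising_binomial \<beta> n * step n x y)"
proof -
  have lt: "\<beta> < real N / (2 * 1)" using assms(4) by simp
  show ?thesis
  proof (rule potential_split[OF assms(1,2) order_refl assms(3) lt])
    assume "\<And>f x. f \<in> unit_ball 1 \<Longrightarrow> x \<in> carrier G \<Longrightarrow>
      summable (\<lambda>n. rising_binomial \<beta> n * (walk ^^ n) f x)"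
    from this[OF indicator_unit_ball[OF assms(6)] assms(5)] show ?thesis
      by (simp add: step_def)
  qed
qed

lemma set_integrable_heat_kernel:
  assumes "polynomial_growth G S N" "N \<ge> 1" "0 < \<alpha>" "\<alpha> < real N"
    and "x \<in> carrier G" "y \<in> carrier G"
  shows "set_integrable lborel {0<..} (\<lambda>t. heat_kernel G S t x y * t powr (-1 + \<alpha> / 2))"
  using summable_rising_binomial_step[OF assms(1,2) _ _ assms(5,6), of "\<alpha> / 2"] assms
  by (intro green_eq(1) polynomial_growth_words[OF assms(1,2)]) (auto simp: rising_binomial_def)

lemma green_eq_rising_binomial:
  assumes "polynomial_growth G S N" "N \<ge> 1" "0 < \<alpha>" "\<alpha> < real N"
    and "x \<in> carrier G" "y \<in> carrier G"
  shows "green G S \<alpha> x y =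
    real (card S) powr - (\<alpha> / 2) * (\<Sum>n. rising_binomial (\<alpha> / 2) n * step n x y)"
  using summable_rising_binomial_step[OF assms(1,2) _ _ assms(5,6), of "\<alpha> / 2"] assms
    green_eq(2)[OF assms(5) polynomial_growth_words(1)[OF assms(1,2)] assms(3), of y]
  by (simp add: rising_binomial_def)

lemma green_nonneg:
  assumes "polynomial_growth G S N" "N \<ge> 1" "0 < \<alpha>" "\<alpha> < real N"
    and "x \<in> carrier G" "y \<in> carrier G"
  shows "green G S \<alpha> x y \<ge> 0"
  unfolding green_eq_rising_binomial[OF assms]
  using assms summable_rising_binomial_step[OF assms(1,2) _ _ assms(5,6), of "\<alpha> / 2"]
  by (intro mult_nonneg_nonneg suminf_nonneg rising_binomial_nonneg step_nonneg) auto

text \<open>A finite sum over \<open>y\<close> commutes with the series over \<open>n\<close>, so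
  the partial sums of the convolution are at most \<open>d * potential \<beta> f x\<close>. This
  gives convergence and the pointwise bound at once, and the strong bound does the rest.\<close>

lemma green_conv_unit_ball:
  assumes "polynomial_growth G S N" "N \<ge> 1" "0 < \<alpha>" "\<alpha> < real N" "1 < r" "r < real N / \<alpha>"
  defines "t \<equiv> real N * r / (real N - \<alpha> * r)"
  obtains K where "K \<ge> 0"
    "\<And>f x. f \<in> unit_ball r \<Longrightarrow> x \<in> carrier G \<Longrightarrow> (\<lambda>y. green G S \<alpha> x y * f y) summable_on carrier G"
    "\<And>f. f \<in> unit_ball r \<Longrightarrow> (\<lambda>x. green_conv G S \<alpha> f x powr t) summable_on carrier G"
    "\<And>f. f \<in> unit_ball r \<Longrightarrow> (\<Sum>\<^sub>\<infinity>x\<in>carrier G. green_conv G S \<alpha> f x powr t) \<le> K"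
proof -
  define \<beta> where "\<beta> = \<alpha> / 2"
  define \<gamma> where "\<gamma> = real N / (2 * r)"
  define d where "d = real (card S) powr - \<beta>"
  have \<beta>: "\<beta> > 0" using assms by (simp add: \<beta>_def)
  have r: "\<alpha> * r < real N" using assms by (simp add: field_simps)
  have \<beta>\<gamma>: "\<beta> < \<gamma>"
    using r assms(5) by (simp add: \<beta>_def \<gamma>_def field_simps)
  have t: "t = real N / (2 * (\<gamma> - \<beta>))"
  proof -
    have "2 * (\<gamma> - \<beta>) = (real N - \<alpha> * r) / r"
      using assms(5) by (simp add: \<beta>_def \<gamma>_def field_simps)
    then show ?thesis by (simp add: t_def)
  qed
  have t0: "t > 0" using assms r unfolding t_def by (intro divide_pos_pos mult_pos_pos) auto
  have B: "summable (\<lambda>n. rising_binomial \<beta> n * (walk ^^ n) f x)"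
    if "f \<in> unit_ball r" "x \<in> carrier G" for f x
    using potential_split[OF assms(1,2) less_imp_le[OF assms(5)] \<beta> \<beta>\<gamma>[unfolded \<gamma>_def]] that by blast
  obtain K where K: "K \<ge> 0" "\<And>f F. f \<in> unit_ball r \<Longrightarrow> finite F \<Longrightarrow> F \<subseteq> carrier G \<Longrightarrow>
      (\<Sum>x\<in>F. potential \<beta> f x powr t) \<le> K"
    using potential_strong_bound[OF assms(1,2,5) \<beta> \<beta>\<gamma>[unfolded \<gamma>_def]]
    unfolding t \<gamma>_def by blast
  have part: "(\<Sum>y\<in>F. green G S \<alpha> x y * f y) \<le> d * potential \<beta> f x"
    if f: "f \<in> unit_ball r" and x: "x \<in> carrier G" and F: "finite F" "F \<subseteq> carrier G" for f x F
  proof -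
    have f0: "\<And>y. y \<in> carrier G \<Longrightarrow> f y \<ge> 0" using f by (simp add: unit_ball_def)
    have sm: "summable (\<lambda>n. rising_binomial \<beta> n * step n x y)" if "y \<in> F" for y
      using that F assms(4) by (intro summable_rising_binomial_step[OF assms(1,2) \<beta>] x) (auto simp: \<beta>_def)
    have "(\<Sum>y\<in>F. green G S \<alpha> x y * f y) =
        (\<Sum>y\<in>F. d * (\<Sum>n. rising_binomial \<beta> n * step n x y) * f y)"
      using F x green_eq_rising_binomial[OF assms(1-4)]
      by (intro sum.cong) (auto simp: d_def \<beta>_def subset_iff)
    also have "\<dots> = d * (\<Sum>y\<in>F. \<Sum>n. rising_binomial \<beta> n * step n x y * f y)"
      using sm by (simp add: sum_distrib_left suminf_mult2 mult.assoc)
    also have "(\<Sum>y\<in>F. \<Sum>n. rising_binomial \<beta> n * step n x y * f y) =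
        (\<Sum>n. \<Sum>y\<in>F. rising_binomial \<beta> n * step n x y * f y)"
      using sm by (intro suminf_sum[symmetric] summable_mult2)
    also have "\<dots> \<le> potential \<beta> f x"
      unfolding potential_def
    proof (rule suminf_le)
      fix n
      have "(\<Sum>y\<in>F. step n x y * f y) \<le> (walk ^^ n) f x"
        using F f0 step_nonneg[OF x] by (intro finite_sum_le_has_sum[OF walk_pow_has_sum[OF x]]) auto
      then have "rising_binomial \<beta> n * (\<Sum>y\<in>F. step n x y * f y) \<le> rising_binomial \<beta> n * (walk ^^ n) f x"
        by (intro mult_left_mono rising_binomial_nonneg \<beta>)
      then show "(\<Sum>y\<in>F. rising_binomial \<beta> n * step n x y * f y) \<le> rising_binomial \<beta> n * (walk ^^ n) f x"
        by (simp add: sum_distrib_left mult.assoc)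
    next
      show "summable (\<lambda>n. \<Sum>y\<in>F. rising_binomial \<beta> n * step n x y * f y)"
        using sm by (intro summable_sum summable_mult2)
    qed (rule B[OF f x])
    finally show ?thesis by (simp add: d_def mult_left_mono)
  qed
  have sg: "(\<lambda>y. green G S \<alpha> x y * f y) summable_on carrier G"
    if f: "f \<in> unit_ball r" and x: "x \<in> carrier G" for f x
  proof (rule nonneg_bdd_above_summable_on)
    show "0 \<le> green G S \<alpha> x y * f y" if "y \<in> carrier G" for y
      using f that x by (intro mult_nonneg_nonneg green_nonneg[OF assms(1-4)]) (auto simp: unit_ball_def)
    show "bdd_above (sum (\<lambda>y. green G S \<alpha> x y * f y) ` {F. F \<subseteq> carrier G \<and> finite F})"
      using part[OF f x] by (intro bdd_aboveI2[where M = "d * potential \<beta> f x"]) auto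
  qed
  have bound: "(\<Sum>x\<in>F. green_conv G S \<alpha> f x powr t) \<le> d powr t * K"
    if f: "f \<in> unit_ball r" and F: "finite F" "F \<subseteq> carrier G" for f F
  proof -
    have "(\<Sum>x\<in>F. green_conv G S \<alpha> f x powr t) \<le> (\<Sum>x\<in>F. d powr t * potential \<beta> f x powr t)"
    proof (rule sum_mono)
      fix x assume "x \<in> F"
      then have x: "x \<in> carrier G" using F by auto
      have "green_conv G S \<alpha> f x \<le> d * potential \<beta> f x"
        unfolding green_conv_def by (rule infsum_le_finite_sums[OF sg[OF f x] part[OF f x]])
      moreover have "green_conv G S \<alpha> f x \<ge> 0"
        unfolding green_conv_def using f x
        by (intro infsum_nonneg mult_nonneg_nonneg green_nonneg[OF assms(1-4)]) (auto simp: unit_ball_def)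
      ultimately have "green_conv G S \<alpha> f x powr t \<le> (d * potential \<beta> f x) powr t"
        using t0 by (intro powr_mono2) auto
      then show "green_conv G S \<alpha> f x powr t \<le> d powr t * potential \<beta> f x powr t"
        by (simp add: powr_mult)
    qed
    also have "\<dots> = d powr t * (\<Sum>x\<in>F. potential \<beta> f x powr t)"
      by (simp add: sum_distrib_left)
    also have "\<dots> \<le> d powr t * K"
      using K(2)[OF f F] by (intro mult_left_mono) auto
    finally show ?thesis .
  qed
  show ?thesis
  proof (rule that[of "d powr t * K"])
    show "d powr t * K \<ge> 0" using K(1) by simp
    fix f assume f: "f \<in> unit_ball r"
    show "(\<lambda>y. green G S \<alpha> x y * f y) summable_on carrier G" if "x \<in> carrier G" for x
      using f that by (rule sg)
    show sm: "(\<lambda>x. green_conv G S \<alpha> f x powr t) summable_on carrier G"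
    proof (rule nonneg_bdd_above_summable_on)
      show "bdd_above (sum (\<lambda>x. green_conv G S \<alpha> f x powr t) ` {F. F \<subseteq> carrier G \<and> finite F})"
        by (rule bdd_aboveI2[where M = "d powr t * K"]) (use bound[OF f] in auto)
    qed simp
    show "(\<Sum>\<^sub>\<infinity>x\<in>carrier G. green_conv G S \<alpha> f x powr t) \<le> d powr t * K"
      by (rule infsum_le_finite_sums[OF sm bound[OF f]])
  qed
qed

section \<open>The linear and the bilinear inequality for general functions\<close>

lemma lp_normalize:
  assumes "f \<in> lp_space (carrier G) r" "r > 0"
  obtains f' where "f' \<in> unit_ball r" "\<And>x. x \<in> carrier G \<Longrightarrow> \<bar>f x\<bar> = lp_norm (carrier G) r f * f' x"
proof (cases "lp_norm (carrier G) r f = 0")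
  \<comment> \<open>Division by the norm is impossible here, but \<open>f\<close> vanishes on the
    carrier and the zero function serves.\<close>
  case True
  have sm: "(\<lambda>x. \<bar>f x\<bar> powr r) summable_on carrier G"
    using assms(1) by (simp add: lp_space_def)
  have z: "f x = 0" if x: "x \<in> carrier G" for x
  proof -
    have "\<bar>f x\<bar> powr r \<le> (\<Sum>\<^sub>\<infinity>x\<in>carrier G. \<bar>f x\<bar> powr r)"
      using finite_sum_le_infsum[OF sm, of "{x}"] x by simp
    with True show ?thesis by (simp add: lp_norm_def)
  qed
  show ?thesis
    by (rule that[of "\<lambda>x. 0"]) (auto simp: unit_ball_def z)
next
  case False
  define Z where "Z = lp_norm (carrier G) r f"
  have Z: "Z > 0" using False lp_norm_nonneg[of "carrier G" r f] by (simp add: Z_def)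
  have sm: "(\<lambda>x. \<bar>f x\<bar> powr r) summable_on carrier G"
    using assms(1) by (simp add: lp_space_def)
  have Zr: "Z powr r = (\<Sum>\<^sub>\<infinity>x\<in>carrier G. \<bar>f x\<bar> powr r)"
    using assms(2) by (simp add: Z_def lp_norm_def powr_powr infsum_nonneg)
  have "((\<lambda>x. inverse (Z powr r) * \<bar>f x\<bar> powr r) has_sum (inverse (Z powr r) * Z powr r)) (carrier G)"
    unfolding Zr by (intro has_sum_cmult_right has_sum_infsum sm)
  moreover have "inverse (Z powr r) * \<bar>f x\<bar> powr r = (\<bar>f x\<bar> / Z) powr r" for x
    using Z by (simp add: powr_divide field_simps)
  ultimately have hs: "((\<lambda>x. (\<bar>f x\<bar> / Z) powr r) has_sum 1) (carrier G)"
    using Z by simp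
  show ?thesis
  proof (rule that[of "\<lambda>x. \<bar>f x\<bar> / Z"])
    show "(\<lambda>x. \<bar>f x\<bar> / Z) \<in> unit_ball r"
      using hs Z by (auto simp: unit_ball_def has_sum_iff)
    show "\<bar>f x\<bar> = lp_norm (carrier G) r f * (\<bar>f x\<bar> / Z)" for x
      using Z by (simp add: Z_def)
  qed
qed

text \<open>The kernel is nonnegative, so with \<open>\<bar>f\<bar> = Z * f'\<close> the convolution
  of \<open>f\<close> is bounded by \<open>Z\<close> times that of \<open>f'\<close>; homogeneity
  yields the constant \<open>K powr (1 / t)\<close>.\<close>

lemma green_conv_lp_bound:
  assumes "polynomial_growth G S N" "N \<ge> 1" "0 < \<alpha>" "\<alpha> < real N" "1 < r" "r < real N / \<alpha>"
  defines "t \<equiv> real N * r / (real N - \<alpha> * r)"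
  shows "\<exists>C. \<forall>f\<in>lp_space (carrier G) r.
    (\<forall>x\<in>carrier G. (\<lambda>y. green G S \<alpha> x y * f y) summable_on carrier G) \<and>
    green_conv G S \<alpha> f \<in> lp_space (carrier G) t \<and>
    lp_norm (carrier G) t (green_conv G S \<alpha> f) \<le> C * lp_norm (carrier G) r f"
proof -
  obtain K where K: "K \<ge> 0"
    "\<And>f x. f \<in> unit_ball r \<Longrightarrow> x \<in> carrier G \<Longrightarrow> (\<lambda>y. green G S \<alpha> x y * f y) summable_on carrier G"
    "\<And>f. f \<in> unit_ball r \<Longrightarrow> (\<lambda>x. green_conv G S \<alpha> f x powr t) summable_on carrier G"
    "\<And>f. f \<in> unit_ball r \<Longrightarrow> (\<Sum>\<^sub>\<infinity>x\<in>carrier G. green_conv G S \<alpha> f x powr t) \<le> K"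
    using green_conv_unit_ball[OF assms(1-6)] unfolding t_def by blast
  have r: "\<alpha> * r < real N" using assms by (simp add: field_simps)
  have t0: "t > 0" using assms r unfolding t_def by (intro divide_pos_pos mult_pos_pos) auto
  show ?thesis
  proof (intro exI[of _ "K powr (1 / t)"] ballI)
    fix f assume f: "f \<in> lp_space (carrier G) r"
    define Z where "Z = lp_norm (carrier G) r f"
    have Z: "Z \<ge> 0" by (simp add: Z_def lp_norm_nonneg)
    obtain f' where f': "f' \<in> unit_ball r" "\<And>x. x \<in> carrier G \<Longrightarrow> \<bar>f x\<bar> = Z * f' x"
      using lp_normalize[OF f] assms(5) unfolding Z_def by auto
    define u where "u = green_conv G S \<alpha> f"
    define u' where "u' = green_conv G S \<alpha> f'"
    have hs: "((\<lambda>y. \<bar>green G S \<alpha> x y * f y\<bar>) has_sum (Z * u' x)) (carrier G)" if x: "x \<in> carrier G" for x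
    proof -
      have "((\<lambda>y. Z * (green G S \<alpha> x y * f' y)) has_sum (Z * u' x)) (carrier G)"
        unfolding u'_def green_conv_def by (intro has_sum_cmult_right has_sum_infsum K(2) f' x)
      then show ?thesis
        by (rule has_sum_cong[THEN iffD1, rotated])
          (use x green_nonneg[OF assms(1-4) x] f'(2) in \<open>simp add: abs_mult\<close>)
    qed
    have sm: "(\<lambda>y. green G S \<alpha> x y * f y) summable_on carrier G" if "x \<in> carrier G" for x
      using hs[OF that] by (auto simp: has_sum_iff intro: abs_summable_summable)
    have le: "\<bar>u x\<bar> \<le> Z * u' x" if x: "x \<in> carrier G" for x
    proof -
      have "\<bar>u x\<bar> \<le> (\<Sum>\<^sub>\<infinity>y\<in>carrier G. \<bar>green G S \<alpha> x y * f y\<bar>)"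
        using norm_infsum_bound[of "\<lambda>y. green G S \<alpha> x y * f y" "carrier G"] hs[OF x]
        by (simp add: u_def green_conv_def has_sum_iff)
      then show ?thesis using hs[OF x] by (simp add: has_sum_iff)
    qed
    have u'0: "u' x \<ge> 0" if "x \<in> carrier G" for x
      unfolding u'_def green_conv_def using f' that
      by (intro infsum_nonneg mult_nonneg_nonneg green_nonneg[OF assms(1-4)]) (auto simp: unit_ball_def)
    have pw: "\<bar>u x\<bar> powr t \<le> Z powr t * u' x powr t" if "x \<in> carrier G" for x
      using powr_mono2[OF less_imp_le[OF t0] abs_ge_zero le[OF that]] by (simp add: powr_mult)
    have su': "(\<lambda>x. Z powr t * u' x powr t) summable_on carrier G"
      unfolding u'_def by (intro summable_on_cmult_right K(3) f')
    have su: "(\<lambda>x. \<bar>u x\<bar> powr t) summable_on carrier G"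
      using pw by (intro summable_on_comparison_test[OF su']) auto
    have "(\<Sum>\<^sub>\<infinity>x\<in>carrier G. \<bar>u x\<bar> powr t) \<le> (\<Sum>\<^sub>\<infinity>x\<in>carrier G. Z powr t * u' x powr t)"
      using pw by (intro infsum_mono su su')
    also have "\<dots> = Z powr t * (\<Sum>\<^sub>\<infinity>x\<in>carrier G. u' x powr t)"
      unfolding u'_def by (intro infsum_cmult_right K(3) f')
    also have "\<dots> \<le> Z powr t * K"
      using K(4)[OF f'(1)] unfolding u'_def by (intro mult_left_mono) auto
    finally have "lp_norm (carrier G) t u \<le> (Z powr t * K) powr (1 / t)"
      unfolding lp_norm_def using t0 by (intro powr_mono2) (auto intro: infsum_nonneg)
    also have "\<dots> = K powr (1 / t) * Z"
      using Z t0 by (simp add: powr_mult powr_powr)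
    finally show "(\<forall>x\<in>carrier G. (\<lambda>y. green G S \<alpha> x y * f y) summable_on carrier G) \<and>
      green_conv G S \<alpha> f \<in> lp_space (carrier G) t \<and>
      lp_norm (carrier G) t (green_conv G S \<alpha> f) \<le> K powr (1 / t) * lp_norm (carrier G) r f"
      using sm su by (auto simp: u_def Z_def lp_space_def)
  qed
qed

text \<open>Duality: the linear estimate puts the convolution of the second function into the space
  dual to that of the first. The set \<open>A\<close> is kept general; the kernel is nonnegative, so
  restricting the sum does not increase the bound.\<close>

lemma hardy_littlewood_sobolev_bilinear:
  assumes "polynomial_growth G S N" "N \<ge> 1" "0 < \<alpha>" "\<alpha> < real N" "1 < r" "1 < s"
    and "1 / r + 1 / s + (real N - \<alpha>) / real N = 2"
    and A: "A \<subseteq> carrier G \<times> carrier G"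
  obtains C where "\<And>f g. f \<in> lp_space (carrier G) r \<Longrightarrow> g \<in> lp_space (carrier G) s \<Longrightarrow>
    (\<lambda>(x, y). green G S \<alpha> x y * f x * g y) summable_on A \<and>
    (\<Sum>\<^sub>\<infinity>(x, y)\<in>A. green G S \<alpha> x y * f x * g y) \<le> C * lp_norm (carrier G) r f * lp_norm (carrier G) s g"
proof -
  \<comment> \<open>The target exponent of the linear estimate for \<open>s\<close>; the relation
    between the exponents makes it conjugate to \<open>r\<close>.\<close>
  define t where "t = real N * s / (real N - \<alpha> * s)"
  have N: "real N > 0" using assms(2) by simp
  have e: "1 / r + 1 / s = 1 + \<alpha> / real N"
    using assms(7) N by (simp add: diff_divide_distrib)
  \<comment> \<open>Here \<open>r > 1\<close> supplies the bound \<open>s < N / \<alpha>\<close>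
    that the linear estimate requires.\<close>
  have "1 / r < 1" using assms(5) by simp
  then have "\<alpha> / real N < 1 / s" using e by linarith
  then have s: "\<alpha> * s < real N" "s < real N / \<alpha>"
    using N assms(3,6) by (simp_all add: field_simps)
  have t0: "t > 0" using N s assms(6) unfolding t_def by (intro divide_pos_pos mult_pos_pos) auto
  have t: "1 / r + 1 / t = 1"
  proof -
    have "1 / t = 1 / s - \<alpha> / real N"
      using N s assms(6) by (simp add: t_def field_simps)
    then show ?thesis using e by simp
  qed
  have t1: "t > 1"
  proof -
    have "1 / t < 1" using t assms(5) by (smt (verit) divide_pos_pos)
    then show ?thesis using t0 by simp
  qed
  obtain K where K: "K \<ge> 0"
    "\<And>f x. f \<in> unit_ball s \<Longrightarrow> x \<in> carrier G \<Longrightarrow> (\<lambda>y. green G S \<alpha> x y * f y) summable_on carrier G"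
    "\<And>f. f \<in> unit_ball s \<Longrightarrow> (\<lambda>x. green_conv G S \<alpha> f x powr t) summable_on carrier G"
    "\<And>f. f \<in> unit_ball s \<Longrightarrow> (\<Sum>\<^sub>\<infinity>x\<in>carrier G. green_conv G S \<alpha> f x powr t) \<le> K"
    using green_conv_unit_ball[OF assms(1-4,6) s(2)] unfolding t_def by blast
  show ?thesis
  proof (rule that[of "1 + K"])
    fix f g assume f: "f \<in> lp_space (carrier G) r" and g: "g \<in> lp_space (carrier G) s"
    define Y where "Y = lp_norm (carrier G) r f"
    define Z where "Z = lp_norm (carrier G) s g"
    have YZ: "Y \<ge> 0" "Z \<ge> 0" by (auto simp: Y_def Z_def lp_norm_nonneg)
    obtain f' where f': "f' \<in> unit_ball r" "\<And>x. x \<in> carrier G \<Longrightarrow> \<bar>f x\<bar> = Y * f' x"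
      using lp_normalize[OF f] assms(5) unfolding Y_def by auto
    obtain g' where g': "g' \<in> unit_ball s" "\<And>x. x \<in> carrier G \<Longrightarrow> \<bar>g x\<bar> = Z * g' x"
      using lp_normalize[OF g] assms(6) unfolding Z_def by auto
    define u where "u = green_conv G S \<alpha> g'"
    have f0: "f' x \<ge> 0" "g' x \<ge> 0" if "x \<in> carrier G" for x
      using f'(1) g'(1) that by (auto simp: unit_ball_def)
    have u0: "u x \<ge> 0" if "x \<in> carrier G" for x
      unfolding u_def green_conv_def using that f0
      by (intro infsum_nonneg mult_nonneg_nonneg green_nonneg[OF assms(1-4)]) auto
    \<comment> \<open>After normalization a uniform constant suffices, so Young's inequality takes
      the place of Hoelder's.\<close>
    have young: "f' x * u x \<le> f' x powr r + u x powr t" if x: "x \<in> carrier G" for x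
    proof -
      have "f' x * u x \<le> f' x powr r / r + u x powr t / t"
        using Youngs_inequality[of r t "f' x" "u x"] assms(5) t1 t f0[OF x] u0[OF x] by simp
      also have "\<dots> \<le> f' x powr r + u x powr t"
        using assms(5) t1 by (intro add_mono) (auto simp: divide_le_eq mult_le_cancel_left1)
      finally show ?thesis .
    qed
    have sf: "((\<lambda>x. f' x powr r + u x powr t) has_sum
        ((\<Sum>\<^sub>\<infinity>x\<in>carrier G. f' x powr r) + (\<Sum>\<^sub>\<infinity>x\<in>carrier G. u x powr t))) (carrier G)"
      unfolding u_def using f'(1) by (intro has_sum_add has_sum_infsum K(3) g') (auto simp: unit_ball_def)
    have sfu: "(\<lambda>x. f' x * u x) summable_on carrier G"
      using young f0 u0
      by (intro summable_on_comparison_test[OF has_sum_imp_summable[OF sf]]) auto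
    have "(\<Sum>\<^sub>\<infinity>x\<in>carrier G. f' x * u x) \<le>
        (\<Sum>\<^sub>\<infinity>x\<in>carrier G. f' x powr r) + (\<Sum>\<^sub>\<infinity>x\<in>carrier G. u x powr t)"
      by (rule has_sum_mono[OF has_sum_infsum[OF sfu] sf young])
    also have "\<dots> \<le> 1 + K"
      using f'(1) K(4)[OF g'(1)] by (auto simp: unit_ball_def u_def intro: add_mono)
    finally have fu: "(\<Sum>\<^sub>\<infinity>x\<in>carrier G. f' x * u x) \<le> 1 + K" .
    define F where "F = (\<lambda>(x, y). green G S \<alpha> x y * f' x * g' y)"
    have F0: "F (x, y) \<ge> 0" if "x \<in> carrier G" "y \<in> carrier G" for x y
      unfolding F_def using that f0 green_nonneg[OF assms(1-4)] by simp
    have row: "((\<lambda>y. F (x, y)) has_sum (f' x * u x)) (carrier G)" if x: "x \<in> carrier G" for x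
      using has_sum_cmult_right[OF has_sum_infsum[OF K(2)[OF g'(1) x]], of "f' x"]
      by (simp add: F_def u_def green_conv_def mult_ac)
    \<comment> \<open>The row sums \<open>f' x * u x\<close> are summable and the terms nonnegative,
      so the double sum converges over the whole product.\<close>
    have SF: "F summable_on (carrier G \<times> carrier G)"
      using row sfu F0 by (rule summable_on_SigmaI)
    have IF: "(F has_sum (\<Sum>\<^sub>\<infinity>x\<in>carrier G. f' x * u x)) (carrier G \<times> carrier G)"
      using row has_sum_infsum[OF sfu] SF by (rule has_sum_SigmaI)
    define H where "H = (\<lambda>(x, y). green G S \<alpha> x y * f x * g y)"
    have H: "\<bar>H z\<bar> = Y * Z * F z" if "z \<in> carrier G \<times> carrier G" for z
      using that f'(2) g'(2) green_nonneg[OF assms(1-4)]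
      by (auto simp: H_def F_def abs_mult)
    have SFA: "F summable_on A" using SF A by (rule summable_on_subset_banach)
    have SA: "(\<lambda>z. Y * Z * F z) summable_on A" by (intro summable_on_cmult_right SFA)
    have "(\<lambda>z. \<bar>H z\<bar>) summable_on A"
      using SA by (rule summable_on_cong[THEN iffD1, rotated]) (use H A in auto)
    then have SH: "H summable_on A" using abs_summable_summable[of H A] by simp
    have "infsum H A \<le> (\<Sum>\<^sub>\<infinity>z\<in>A. Y * Z * F z)"
    proof (rule infsum_mono[OF SH SA])
      fix z assume "z \<in> A"
      with A have "z \<in> carrier G \<times> carrier G" by blast
      from H[OF this] show "H z \<le> Y * Z * F z" using abs_ge_self[of "H z"] by simp
    qed
    also have "\<dots> = Y * Z * infsum F A"
      by (intro infsum_cmult_right SFA)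
    also have "\<dots> \<le> Y * Z * (1 + K)"
    proof (intro mult_left_mono)
      have "infsum F A \<le> infsum F (carrier G \<times> carrier G)"
        using A F0 by (intro infsum_mono_neutral SFA SF) auto
      also have "\<dots> = (\<Sum>\<^sub>\<infinity>x\<in>carrier G. f' x * u x)" by (rule infsumI[OF IF])
      also have "\<dots> \<le> 1 + K" by (rule fu)
      finally show "infsum F A \<le> 1 + K" .
    qed (use YZ in simp)
    finally have "infsum H A \<le> (1 + K) * Y * Z" by (simp only: mult_ac)
    with SH show "(\<lambda>(x, y). green G S \<alpha> x y * f x * g y) summable_on A \<and>
      (\<Sum>\<^sub>\<infinity>(x, y)\<in>A. green G S \<alpha> x y * f x * g y) \<le> (1 + K) * lp_norm (carrier G) r f * lp_norm (carrier G) s g"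
      by (simp add: H_def Y_def Z_def)
  qed
qed

end

text \<open>The first conjunct ensures that the integral in \<open>green\<close> is a genuine one,
  and the summability clauses do the same for the infinite sums; otherwise these expressions could
  take the default value 0.\<close>

theorem theorem2p2:
  fixes G :: "('a, 'b) monoid_scheme" and S :: "'a set" and N :: nat
  assumes "group G"
    and "symmetric_generating_set G S"
    and "polynomial_growth G S N"
    and "N \<ge> 3"
  shows
    "(\<forall>\<alpha>::real. 0 < \<alpha> \<and> \<alpha> < real N \<longrightarrow>
        (\<forall>x\<in>carrier G. \<forall>y\<in>carrier G.
           set_integrable lborel {0<..} (\<lambda>t. heat_kernel G S t x y * t powr (-1 + \<alpha> / 2)))) \<and>
     (\<forall>r s \<alpha>::real. r > 1 \<and> s > 1 \<and> 0 < \<alpha> \<and> \<alpha> < real N \<and>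
          1 / r + 1 / s + (real N - \<alpha>) / real N = 2 \<longrightarrow>
        (\<exists>C::real. \<forall>f\<in>lp_space (carrier G) r. \<forall>g\<in>lp_space (carrier G) s.
           (\<lambda>(x, y). green G S \<alpha> x y * f x * g y)
              summable_on {(x, y). x \<in> carrier G \<and> y \<in> carrier G \<and> x \<noteq> y} \<and>
           (\<Sum>\<^sub>\<infinity>(x, y)\<in>{(x, y). x \<in> carrier G \<and> y \<in> carrier G \<and> x \<noteq> y}. green G S \<alpha> x y * f x * g y)
              \<le> C * lp_norm (carrier G) r f * lp_norm (carrier G) s g)) \<and>
     (\<forall>\<alpha> r t::real. 0 < \<alpha> \<and> \<alpha> < real N \<and> 1 < r \<and> r < real N / \<alpha> \<and>
          t = real N * r / (real N - \<alpha> * r) \<longrightarrow>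
        (\<exists>C::real. \<forall>f\<in>lp_space (carrier G) r.
           (\<forall>x\<in>carrier G. (\<lambda>y. green G S \<alpha> x y * f y) summable_on carrier G) \<and>
           green_conv G S \<alpha> f \<in> lp_space (carrier G) t \<and>
           lp_norm (carrier G) t (green_conv G S \<alpha> f) \<le> C * lp_norm (carrier G) r f))"
proof -
  interpret group G by fact
  interpret cayley_graph G S by unfold_locales fact
  have N: "N \<ge> 1" using assms(4) by simp
  show ?thesis
  proof (intro conjI allI impI ballI)
    fix \<alpha> :: real and x y
    assume "0 < \<alpha> \<and> \<alpha> < real N" "x \<in> carrier G" "y \<in> carrier G"
    then show "set_integrable lborel {0<..} (\<lambda>t. heat_kernel G S t x y * t powr (-1 + \<alpha> / 2))"
      using set_integrable_heat_kernel[OF assms(3) N] by blast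
  next
    fix r s \<alpha> :: real
    let ?A = "{(x, y). x \<in> carrier G \<and> y \<in> carrier G \<and> x \<noteq> y}"
    assume "r > 1 \<and> s > 1 \<and> 0 < \<alpha> \<and> \<alpha> < real N \<and> 1 / r + 1 / s + (real N - \<alpha>) / real N = 2"
    then obtain C where "\<And>f g. f \<in> lp_space (carrier G) r \<Longrightarrow> g \<in> lp_space (carrier G) s \<Longrightarrow>
        (\<lambda>(x, y). green G S \<alpha> x y * f x * g y) summable_on ?A \<and>
        (\<Sum>\<^sub>\<infinity>(x, y)\<in>?A. green G S \<alpha> x y * f x * g y)
          \<le> C * lp_norm (carrier G) r f * lp_norm (carrier G) s g"
      using hardy_littlewood_sobolev_bilinear[OF assms(3) N, of \<alpha> r s ?A] by blast
    then show "\<exists>C::real. \<forall>f\<in>lp_space (carrier G) r. \<forall>g\<in>lp_space (carrier G) s.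
        (\<lambda>(x, y). green G S \<alpha> x y * f x * g y) summable_on ?A \<and>
        (\<Sum>\<^sub>\<infinity>(x, y)\<in>?A. green G S \<alpha> x y * f x * g y)
          \<le> C * lp_norm (carrier G) r f * lp_norm (carrier G) s g"
      by blast
  next
    fix \<alpha> r t :: real
    assume *: "0 < \<alpha> \<and> \<alpha> < real N \<and> 1 < r \<and> r < real N / \<alpha> \<and>
      t = real N * r / (real N - \<alpha> * r)"
    then have t: "t = real N * r / (real N - \<alpha> * r)" by simp
    have "0 < \<alpha>" "\<alpha> < real N" "1 < r" "r < real N / \<alpha>" using * by auto
    from green_conv_lp_bound[OF assms(3) N this]
    show "\<exists>C::real. \<forall>f\<in>lp_space (carrier G) r.
        (\<forall>x\<in>carrier G. (\<lambda>y. green G S \<alpha> x y * f y) summable_on carrier G) \<and>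
        green_conv G S \<alpha> f \<in> lp_space (carrier G) t \<and>
        lp_norm (carrier G) t (green_conv G S \<alpha> f) \<le> C * lp_norm (carrier G) r f"
      unfolding t .
  qed
qed

end
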